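(* Let $d \geq 1$ be an integer and let $X$ be a compact metrizable abelian group equipped with an action of $\mathbb{Z}^d$ by continuous group automorphisms. Suppose that $X$ is connected and that $(X,\mathbb{Z}^d)$ is mixing, satisfies the algebraic descending chain condition, and has finite topological entropy. Then the dynamical system $(X,\mathbb{Z}^d)$ is surjunctive, i.e., every injective continuous $\mathbb{Z}^d$-equivariant map $\tau \colon X \to X$ is surjective.
   Context: Let $X$ be a compact metrizable group on which a countable group $\Gamma$ acts by continuous group automorphisms (here $\Gamma = \mathbb{Z}^d$). A map $\tau \colon X \to X$ is $\Gamma$-equivariant if $\tau(\gamma x) = \gamma\tau(x)$ for all $\gamma \in \Gamma$ and $x \in X$ (the map $\tau$ is not assumed to be a group homomorphism). The system $(X,\Gamma)$ is surjunctive if every injective $\Gamma$-equivariant continuous map $\tau \colon X \to X$ is surjective. Let $\lambda_X$ be the Haar probability measure on $X$, which is $\Gamma$-invariant. The system $(X,\Gamma)$ is mixing if $$\lim_{\gamma \to \infty} \lambda_X(A_1 \cap \gamma A_2) = \lambda_X(A_1)\cdot\lambda_X(A_2)$$ for all measurable subsets $A_1,A_2 \subset X$, where $\infty$ denotes the point at infinity in the one-point compactification of the discrete group $\Gamma$ (i.e., the limit is taken as $\gamma$ leaves every finite subset of $\Gamma$). The system $(X,\Gamma)$ satisfies the algebraic descending chain condition if every decreasing sequence $X = X_0 \supset X_1 \supset X_2 \supset \dots$ of $\Gamma$-invariant closed subgroups $X_i \subset X$ ($i \in \mathbb{N}$) eventually stabilizes, i.e., there is an integer $k \geq 0$ such that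 $X_i = X_k$ for all $i \geq k$. The topological entropy of $(X,\mathbb{Z}^d)$ is the usual one for $\mathbb{Z}^d$-actions: for a finite open cover $\mathcal{U}$ of $X$ let $N(\mathcal{U})$ be the minimal cardinality of a subcover, let $Q_n = \{0,\dots,n-1\}^d$, and set $h_{top}(X,\mathbb{Z}^d) = \sup_{\mathcal{U}} \lim_{n\to\infty} \frac{1}{n^d} \log N\big(\bigvee_{\gamma \in Q_n} \gamma^{-1}\mathcal{U}\big) \in [0,\infty]$, where the supremum is over all finite open covers $\mathcal{U}$ of $X$ and $\bigvee$ denotes the common refinement (join) of covers. *)

theory Defs
  imports "HOL-Probability.Probability"
begin

definition algebraic_action ::
    "('g::group_add \<Rightarrow> 'a::topological_group_add \<Rightarrow> 'a) \<Rightarrow> bool" where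
  "algebraic_action \<alpha> \<longleftrightarrow>
     (\<forall>x. \<alpha> 0 x = x) \<and>
     (\<forall>g h x. \<alpha> (g + h) x = \<alpha> g (\<alpha> h x)) \<and>
     (\<forall>g x y. \<alpha> g (x + y) = \<alpha> g x + \<alpha> g y) \<and>
     (\<forall>g. continuous_on UNIV (\<alpha> g))"
  \<comment> \<open>Each map is an automorphism with continuous inverse, because the map at \<open>- g\<close>
      inverts the map at \<open>g\<close>.\<close>

definition equivariant :: "('g \<Rightarrow> 'a \<Rightarrow> 'a) \<Rightarrow> ('a \<Rightarrow> 'a) \<Rightarrow> bool" where
  "equivariant \<alpha> \<tau> \<longleftrightarrow> (\<forall>g x. \<tau> (\<alpha> g x) = \<alpha> g (\<tau> x))"

definition surjunctive :: "('g \<Rightarrow> 'a::topological_space \<Rightarrow> 'a) \<Rightarrow> bool" where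
  "surjunctive \<alpha> \<longleftrightarrow>
     (\<forall>\<tau>. continuous_on UNIV \<tau> \<and> equivariant \<alpha> \<tau> \<and> inj \<tau> \<longrightarrow> surj \<tau>)"

text \<open>
  Regularity is automatic for finite Borel measures on a compact metrizable space. On a compact metrizable group exactly one
  measure satisfies this predicate.
\<close>

definition haar_probability :: "'a::topological_group_add measure \<Rightarrow> bool" where
  "haar_probability \<mu> \<longleftrightarrow>
     prob_space \<mu> \<and> sets \<mu> = sets borel \<and>
     (\<forall>x. \<forall>A \<in> sets borel. emeasure \<mu> ((\<lambda>y. x + y) ` A) = emeasure \<mu> A)"

definition mixing :: "'a measure \<Rightarrow> ('g \<Rightarrow> 'a \<Rightarrow> 'a) \<Rightarrow> bool" where
  "mixing \<mu> \<alpha> \<longleftrightarrow>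
     (\<forall>A \<in> sets \<mu>. \<forall>B \<in> sets \<mu>.
        ((\<lambda>g. measure \<mu> (A \<inter> \<alpha> g ` B)) \<longlongrightarrow> measure \<mu> A * measure \<mu> B) cofinite)"

definition closed_invariant_subgroup ::
    "('g \<Rightarrow> 'a::topological_group_add \<Rightarrow> 'a) \<Rightarrow> 'a set \<Rightarrow> bool" where
  "closed_invariant_subgroup \<alpha> H \<longleftrightarrow>
     closed H \<and> 0 \<in> H \<and> (\<forall>x\<in>H. \<forall>y\<in>H. x + y \<in> H) \<and> (\<forall>x\<in>H. - x \<in> H) \<and>
     (\<forall>g. \<alpha> g ` H \<subseteq> H)"

definition algebraic_dcc :: "('g \<Rightarrow> 'a::topological_group_add \<Rightarrow> 'a) \<Rightarrow> bool" where
  "algebraic_dcc \<alpha> \<longleftrightarrow>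
     (\<forall>H :: nat \<Rightarrow> 'a set.
        H 0 = UNIV \<and> (\<forall>i. closed_invariant_subgroup \<alpha> (H i)) \<and> (\<forall>i. H (Suc i) \<subseteq> H i) \<longrightarrow>
        (\<exists>k. \<forall>i\<ge>k. H i = H k))"

definition finite_open_cover :: "'a::topological_space set set \<Rightarrow> bool" where
  "finite_open_cover U \<longleftrightarrow> finite U \<and> (\<forall>V\<in>U. open V) \<and> \<Union>U = UNIV"

definition cover_number :: "'a set set \<Rightarrow> nat" where
  "cover_number U = Inf {card V | V. V \<subseteq> U \<and> finite V \<and> \<Union>V = UNIV}"

text \<open>
  The join over \<open>g \<in> Q\<close> of the preimages of \<open>U\<close> under \<open>\<alpha> g\<close>: its members are the
  intersections over \<open>g \<in> Q\<close> in which one member \<open>f g\<close> of \<open>U\<close> is chosen for each \<open>g\<close>.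
\<close>

definition join_cover :: "('g \<Rightarrow> 'a \<Rightarrow> 'a) \<Rightarrow> 'g set \<Rightarrow> 'a set set \<Rightarrow> 'a set set" where
  "join_cover \<alpha> Q U = {\<Inter>g\<in>Q. \<alpha> g -` f g | f. \<forall>g\<in>Q. f g \<in> U}"

definition cube :: "nat \<Rightarrow> (int ^ 'd) set" where
  "cube n = {v. \<forall>i. 0 \<le> v $ i \<and> v $ i < int n}"

text \<open>
  For a continuous action the limit exists and is finite, because the logarithm is a subadditive
  function of the finite subset of the group; so \<^const>\<open>lim\<close> is meaningful here.
\<close>

definition topological_entropy ::
    "(int ^ 'd \<Rightarrow> 'a::topological_space \<Rightarrow> 'a) \<Rightarrow> ereal" where
  "topological_entropy \<alpha> =
     (SUP U \<in> {U. finite_open_cover U}.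
        ereal (lim (\<lambda>n. ln (real (cover_number (join_cover \<alpha> (cube n) U))) / real n ^ CARD('d))))"

end

theory Submission
  imports Defs "HOL-Complex_Analysis.Great_Picard" "HOL-Computational_Algebra.Polynomial"
    "HOL-Real_Asymp.Real_Asymp"
begin

text \<open>
  The reason for surjunctivity is rigidity: under these hypotheses every continuous equivariant map
  \<open>\<tau>\<close> is affine, that is, a group endomorphism followed by a translation
  (\<open>equivariant_map_affine\<close>). An injective equivariant endomorphism is onto by the descending chain
  condition applied to the images of its iterates (\<open>injective_endomorphism_surjective\<close>).

  Rigidity is tested on characters, which separate points. For a character \<open>m\<close>, the map \<open>m \<circ> \<tau>\<close> goes
  to the circle, and on a connected group such a map is a constant times a character times \<open>exp (i h)\<close>
  with \<open>h\<close> real and continuous (\<open>circle_map_decomposition\<close>). The point is that \<open>h\<close> is constant.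

  Finite entropy enters through \<open>m\<close>: if its translates under the action were independent, they would
  map onto dense subsets of tori of every dimension and make the entropy infinite. So there is
  a nontrivial multiplicative relation among the translates of \<open>m\<close> (\<open>character_orbit_dependent\<close>).
  Equivariance transports it to \<open>m \<circ> \<tau>\<close>, and because no nontrivial character has a continuous
  logarithm, it becomes a linear relation \<open>p h = 0\<close> with a nonzero Laurent polynomial \<open>p\<close> acting
  through the translates of \<open>h\<close>.

  Mixing excludes this for nonconstant \<open>h\<close> (\<open>annihilated_constant\<close>). The translates of a nontrivial
  character \<open>\<xi>\<close> are pairwise different, hence orthonormal, so the coefficients of \<open>h\<close> along the
  orbit of \<open>\<xi>\<close> form a square-summable function on \<open>\<int>\<^sup>d\<close> killed by \<open>p\<close>. Such a function
  vanishes because the multiples of \<open>p\<close> come arbitrarily close to the unit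
  (\<open>unit_near_multiples\<close>). Thus \<open>h\<close> has no nontrivial Fourier coefficients and is constant by the
  completeness of the characters (\<open>nonzero_coefficient\<close>), which is proved here by a variational
  argument.
\<close>


section \<open>Haar integration on a compact metrizable abelian group\<close>

locale compact_abelian_haar =
  fixes \<mu> :: "'a::topological_ab_group_add measure"
  assumes compact_group: "compact (UNIV :: 'a set)"
    and metrizable_group: "metrizable_space (euclidean :: 'a topology)"
    and haar: "haar_probability \<mu>"
begin

sublocale prob_space \<mu>
  using haar by (simp add: haar_probability_def)

lemma sets_haar [measurable_cong]: "sets \<mu> = sets borel"
  using haar by (simp add: haar_probability_def)

lemma space_haar [simp]: "space \<mu> = UNIV"
  using sets_eq_imp_space_eq[OF sets_haar] by simp

lemma continuous_compose:
  fixes f :: "'a \<Rightarrow> 'b::topological_space"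
  assumes "continuous_on UNIV f" "continuous_on A g"
  shows "continuous_on A (\<lambda>x. f (g x))"
  using continuous_on_compose2[OF assms(1,2)] by simp

lemma continuous_measurable:
  fixes f :: "'a \<Rightarrow> 'b::topological_space"
  assumes "continuous_on UNIV f"
  shows "f \<in> borel_measurable \<mu>"
  using borel_measurable_continuous_onI[OF assms] measurable_cong_sets[OF sets_haar refl] by blast

lemma continuous_bounded:
  fixes f :: "'a \<Rightarrow> 'b::real_normed_vector"
  assumes "continuous_on UNIV f"
  obtains B where "B > 0" "\<And>x. norm (f x) \<le> B"
proof -
  have "compact (range f)"
    using compact_continuous_image[OF assms compact_group] .
  then have "bounded (range f)"
    by (rule compact_imp_bounded)
  then show ?thesis
    using that by (auto simp: bounded_pos)
qed

lemma continuous_integrable [intro]: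
  fixes f :: "'a \<Rightarrow> 'b::{banach, second_countable_topology}"
  assumes "continuous_on UNIV f"
  shows "integrable \<mu> f"
proof -
  obtain B where "\<And>x. norm (f x) \<le> B"
    using continuous_bounded[OF assms] by blast
  then show ?thesis
    by (intro integrable_const_bound[of _ B]) (auto intro: continuous_measurable assms)
qed

lemma distr_translate: "distr \<mu> borel (\<lambda>x. x + t) = \<mu>"
proof (rule measure_eqI)
  show "sets (distr \<mu> borel (\<lambda>x. x + t)) = sets \<mu>"
    by (simp add: sets_haar)
next
  fix A assume "A \<in> sets (distr \<mu> borel (\<lambda>x. x + t))"
  then have A: "A \<in> sets borel" by simp
  have "(\<lambda>x. x + t) \<in> measurable \<mu> borel"
    by (intro continuous_measurable continuous_intros)
  moreover have "(\<lambda>x. x + t) -` A = (\<lambda>y. - t + y) ` A"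
    by (auto simp: image_iff algebra_simps)
  moreover have "emeasure \<mu> ((\<lambda>y. - t + y) ` A) = emeasure \<mu> A"
    using haar A unfolding haar_probability_def by blast
  ultimately show "emeasure (distr \<mu> borel (\<lambda>x. x + t)) A = emeasure \<mu> A"
    using A by (simp add: emeasure_distr)
qed

lemma integral_translate:
  fixes f :: "'a \<Rightarrow> 'b::{banach, second_countable_topology}"
  assumes "continuous_on UNIV f"
  shows "(\<integral>x. f (x + t) \<partial>\<mu>) = (\<integral>x. f x \<partial>\<mu>)"
proof -
  have "(\<lambda>x. x + t) \<in> measurable \<mu> borel"
    by (intro continuous_measurable continuous_intros)
  then have "(\<integral>x. f x \<partial>distr \<mu> borel (\<lambda>x. x + t)) = (\<integral>x. f (x + t) \<partial>\<mu>)"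
    using borel_measurable_continuous_onI[OF assms] by (rule integral_distr)
  then show ?thesis
    by (simp add: distr_translate)
qed

text \<open>Finitely many translates of a nonempty open set cover the group, and all have the same measure.\<close>

lemma measure_open_pos:
  assumes "open U" "U \<noteq> {}"
  shows "measure \<mu> U > 0"
proof (rule ccontr)
  assume "\<not> measure \<mu> U > 0"
  then have 0: "emeasure \<mu> U = 0"
    using measure_nonneg[of \<mu> U] by (simp add: emeasure_eq_measure)
  obtain u where u: "u \<in> U" using assms by auto
  have op: "open ((\<lambda>x. x + (u - t)) -` U)" for t
    by (intro open_vimage assms continuous_intros)
  have "UNIV \<subseteq> (\<Union>t\<in>UNIV. (\<lambda>x. x + (u - t)) -` U)"
  proof
    fix t :: 'a
    have "t \<in> (\<lambda>x. x + (u - t)) -` U" using u by simp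
    then show "t \<in> (\<Union>t\<in>UNIV. (\<lambda>x. x + (u - t)) -` U)" by blast
  qed
  then obtain F where F: "finite F" "UNIV \<subseteq> (\<Union>t\<in>F. (\<lambda>x. x + (u - t)) -` U)"
    by (rule compactE_image[OF compact_group op])
  have 1: "emeasure \<mu> ((\<lambda>x. x + s) -` U) = 0" for s
  proof -
    have "(\<lambda>x. x + s) \<in> measurable \<mu> borel"
      by (intro continuous_measurable continuous_intros)
    then have "emeasure (distr \<mu> borel (\<lambda>x. x + s)) U = emeasure \<mu> ((\<lambda>x. x + s) -` U)"
      using assms by (simp add: emeasure_distr)
    then show ?thesis using 0 by (simp add: distr_translate)
  qed
  have "(\<Union>t\<in>F. (\<lambda>x. x + (u - t)) -` U) \<in> null_sets \<mu>"
    using F 1 op by (intro null_sets_UN' countable_finite) (auto simp: null_sets_def sets_haar)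
  then have "emeasure \<mu> UNIV = 0"
    using F(2) by (simp add: top.extremum_unique null_setsD1)
  then show False
    using emeasure_space_1 by simp
qed

lemma integral_nonneg_eq_0:
  fixes f :: "'a \<Rightarrow> real"
  assumes "continuous_on UNIV f" "\<And>x. f x \<ge> 0" "(\<integral>x. f x \<partial>\<mu>) = 0"
  shows "f x = 0"
proof (rule ccontr)
  assume "f x \<noteq> 0"
  have op: "open {y. 0 < f y}"
    using assms(1) by (intro open_Collect_less continuous_intros) auto
  have "AE y in \<mu>. f y = 0"
    using integral_nonneg_eq_0_iff_AE[of \<mu> f] continuous_integrable[OF assms(1)] assms by simp
  then have "AE y in \<mu>. y \<notin> {y. 0 < f y}"
    by eventually_elim simp
  then have "{y. 0 < f y} \<in> null_sets \<mu>"
    using op by (subst AE_iff_null_sets) (auto simp: sets_haar)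
  then have "measure \<mu> {y. 0 < f y} = 0"
    by (rule measure_eq_0_null_sets)
  then show False
    using measure_open_pos[OF op] \<open>f x \<noteq> 0\<close> assms(2)[of x] by (metis empty_Collect_eq less_eq_real_def order_less_irrefl)
qed

lemma compatible_metric:
  obtains d :: "'a \<Rightarrow> 'a \<Rightarrow> real" where "Metric_space UNIV d"
    "\<And>W. open W \<longleftrightarrow> (\<forall>x\<in>W. \<exists>r>0. Metric_space.mball UNIV d x r \<subseteq> W)"
proof -
  obtain M d where Md: "Metric_space M d" "euclidean = Metric_space.mtopology M (d :: 'a \<Rightarrow> 'a \<Rightarrow> real)"
    using metrizable_group by (auto simp: metrizable_space_def)
  have M: "M = UNIV"
    using Md(2) Metric_space.topspace_mtopology[OF Md(1)] by (metis topspace_euclidean)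
  show ?thesis
  proof (rule that[of d])
    show "Metric_space UNIV d" using Md(1) M by simp
    show "open W \<longleftrightarrow> (\<forall>x\<in>W. \<exists>r>0. Metric_space.mball UNIV d x r \<subseteq> W)" for W
      using Md(2) Metric_space.openin_mtopology[OF Md(1), of W] M by (simp add: open_openin Ball_def)
  qed
qed

text \<open>
  Joint measurability of continuous functions of two variables needs a countable base, so that open
  sets of the product are countable unions of open rectangles.
\<close>

lemma countable_base:
  obtains \<B> :: "'a set set" where "countable \<B>" "\<And>B. B \<in> \<B> \<Longrightarrow> open B"
    "\<And>W x. open W \<Longrightarrow> x \<in> W \<Longrightarrow> \<exists>B\<in>\<B>. x \<in> B \<and> B \<subseteq> W"
proof -
  obtain d :: "'a \<Rightarrow> 'a \<Rightarrow> real" where d: "Metric_space UNIV d"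
    and op: "\<And>W. open W \<longleftrightarrow> (\<forall>x\<in>W. \<exists>r>0. Metric_space.mball UNIV d x r \<subseteq> W)"
    using compatible_metric by blast
  interpret Metric_space UNIV d by (rule d)
  have op_ball: "open (mball x r)" for x :: 'a and r
    using openin_mball by (simp add: op openin_mtopology Ball_def)
  have "\<exists>F. finite F \<and> UNIV \<subseteq> (\<Union>c\<in>F. mball c (1 / Suc n))" for n
  proof -
    have "UNIV \<subseteq> (\<Union>c\<in>UNIV. mball c (1 / Suc n))" by auto
    then obtain F where "finite F" "UNIV \<subseteq> (\<Union>c\<in>F. mball c (1 / Suc n))"
      by (rule compactE_image[OF compact_group op_ball])
    then show ?thesis by blast
  qed
  then obtain F where F: "\<And>n. finite (F n)" "\<And>n. UNIV \<subseteq> (\<Union>c\<in>F n. mball c (1 / Suc n))"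
    by metis
  define \<B> where "\<B> = (\<Union>n. (\<lambda>c. mball c (1 / Suc n)) ` F n)"
  show ?thesis
  proof
    show "countable \<B>"
      unfolding \<B>_def using F by (auto intro: countable_finite)
    show "open B" if "B \<in> \<B>" for B
      using that op_ball by (auto simp: \<B>_def)
    fix W :: "'a set" and x assume "open W" "x \<in> W"
    then obtain r where r: "r > 0" "mball x r \<subseteq> W" using op[of W] by metis
    obtain n where n: "1 / Suc n < r / 2"
      using r reals_Archimedean[of "r/2"] by (auto simp: field_simps)
    obtain c where c: "c \<in> F n" "x \<in> mball c (1 / Suc n)" using F(2)[of n] by blast
    have "mball c (1 / Suc n) \<subseteq> mball x r"
    proof
      fix y assume y: "y \<in> mball c (1 / Suc n)"
      have "d x y \<le> d c x + d c y" using triangle[of x c y] commute by simp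
      also have "\<dots> < r" using c y n by simp
      finally show "y \<in> mball x r" by simp
    qed
    then show "\<exists>B\<in>\<B>. x \<in> B \<and> B \<subseteq> W"
      using r c unfolding \<B>_def by blast
  qed
qed

lemma Hausdorff_group: "Hausdorff_space (euclidean :: 'a topology)"
  using metrizable_group by (rule metrizable_imp_Hausdorff_space)

lemma closed_if_compact:
  assumes "compact (S :: 'a set)" shows "closed S"
  using compactin_imp_closedin[OF Hausdorff_group, of S] assms by simp

lemma continuous_separates:
  fixes a b :: 'a
  assumes "a \<noteq> b"
  obtains f :: "'a \<Rightarrow> real" where "continuous_on UNIV f" "f a \<noteq> f b"
proof -
  obtain d :: "'a \<Rightarrow> 'a \<Rightarrow> real" where d: "Metric_space UNIV d"
    and op: "\<And>W. open W \<longleftrightarrow> (\<forall>x\<in>W. \<exists>r>0. Metric_space.mball UNIV d x r \<subseteq> W)"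
    using compatible_metric by blast
  interpret Metric_space UNIV d by (rule d)
  have "continuous_on UNIV (d a)"
  proof (rule continuous_on_open_vimage[THEN iffD2, rule_format, OF open_UNIV])
    fix V :: "real set" assume "open V"
    show "open (d a -` V \<inter> UNIV)"
      unfolding op
    proof
      fix x assume "x \<in> d a -` V \<inter> UNIV"
      then obtain e where e: "e > 0" "ball (d a x) e \<subseteq> V"
        using open_contains_ball_eq[OF \<open>open V\<close>, of "d a x"] by auto
      have "mball x e \<subseteq> d a -` V \<inter> UNIV"
      proof
        fix y assume "y \<in> mball x e"
        then have "\<bar>d a x - d a y\<bar> < e"
          using triangle[of a x y] triangle[of a y x] commute[of x y] by auto
        then show "y \<in> d a -` V \<inter> UNIV" using e by (auto simp: dist_real_def)
      qed
      then show "\<exists>r>0. mball x r \<subseteq> d a -` V \<inter> UNIV" using e by blast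
    qed
  qed
  moreover have "d a a \<noteq> d a b" using assms by (metis UNIV_I zero)
  ultimately show ?thesis using that by blast
qed

lemma continuous_pair_measurable:
  fixes F :: "'a \<times> 'a \<Rightarrow> 'b::topological_space"
  assumes "continuous_on UNIV F" and sets: "sets M = sets borel" "sets N = sets borel"
  shows "F \<in> borel_measurable (M \<Otimes>\<^sub>M N)"
proof (rule borel_measurableI)
  fix S :: "'b set" assume "open S"
  then have opW: "open (F -` S)"
    using assms(1) by (intro open_vimage)
  obtain \<B> :: "'a set set" where \<B>: "countable \<B>" "\<And>B. B \<in> \<B> \<Longrightarrow> open B"
    "\<And>W x. open W \<Longrightarrow> x \<in> W \<Longrightarrow> \<exists>B\<in>\<B>. x \<in> B \<and> B \<subseteq> W"
    using countable_base by blast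
  define R where "R = {AB \<in> \<B> \<times> \<B>. fst AB \<times> snd AB \<subseteq> F -` S}"
  have R: "countable R" unfolding R_def using \<B>(1) by (intro countable_Collect) auto
  have "F -` S = (\<Union>AB\<in>R. fst AB \<times> snd AB)"
  proof (intro equalityI subsetI)
    fix z assume "z \<in> F -` S"
    then obtain A B where AB: "open A" "open B" "z \<in> A \<times> B" "A \<times> B \<subseteq> F -` S"
      by (rule open_prod_elim[OF opW])
    obtain A' where A': "A' \<in> \<B>" "fst z \<in> A'" "A' \<subseteq> A"
      using \<B>(3)[OF AB(1), of "fst z"] AB(3) by auto
    obtain B' where B': "B' \<in> \<B>" "snd z \<in> B'" "B' \<subseteq> B"
      using \<B>(3)[OF AB(2), of "snd z"] AB(3) by auto
    have "(A', B') \<in> R" using A' B' AB(4) by (auto simp: R_def)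
    moreover have "z \<in> A' \<times> B'" using A' B' by (cases z) auto
    ultimately show "z \<in> (\<Union>AB\<in>R. fst AB \<times> snd AB)"
      by (intro UN_I[of "(A', B')"]) simp_all
  next
    show "z \<in> F -` S" if "z \<in> (\<Union>AB\<in>R. fst AB \<times> snd AB)" for z
      using that unfolding R_def by blast
  qed
  also have "\<dots> \<in> sets (M \<Otimes>\<^sub>M N)"
    using R \<B>(2) sets by (intro sets.countable_UN') (auto simp: R_def)
  finally have "F -` S \<in> sets (M \<Otimes>\<^sub>M N)" .
  moreover have "space (M \<Otimes>\<^sub>M N) = UNIV"
    using sets_eq_imp_space_eq[OF sets(1)] sets_eq_imp_space_eq[OF sets(2)] by (simp add: space_pair_measure)
  ultimately show "F -` S \<inter> space (M \<Otimes>\<^sub>M N) \<in> sets (M \<Otimes>\<^sub>M N)" by simp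
qed

lemma Fubini_continuous:
  fixes F :: "'a \<Rightarrow> 'a \<Rightarrow> 'b::{banach, second_countable_topology}"
  assumes F: "continuous_on UNIV (\<lambda>z. F (fst z) (snd z))"
    and N: "prob_space N" "sets N = sets borel"
  shows "(\<integral>x. \<integral>y. F x y \<partial>N \<partial>\<mu>) = (\<integral>y. \<integral>x. F x y \<partial>\<mu> \<partial>N)"
proof -
  interpret N: prob_space N by (rule N)
  interpret pair_prob_space \<mu> N ..
  have "compact (range (\<lambda>z. F (fst z) (snd z)))"
    using compact_continuous_image[OF F] compact_Times[OF compact_group compact_group] by simp
  then obtain B where B: "\<And>x y. norm (F x y) \<le> B"
    by (fastforce dest!: compact_imp_bounded simp: bounded_pos)
  have "integrable (\<mu> \<Otimes>\<^sub>M N) (case_prod F)"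
  proof (rule integrable_const_bound)
    show "AE z in \<mu> \<Otimes>\<^sub>M N. norm (case_prod F z) \<le> B" using B by auto
    show "case_prod F \<in> borel_measurable (\<mu> \<Otimes>\<^sub>M N)"
      using continuous_pair_measurable[OF F sets_haar N(2)] by (simp add: case_prod_beta')
  qed
  from Fubini_integral[OF this] show ?thesis by simp
qed

text \<open>
  A continuous function on a compact group is uniformly continuous: the tube lemma applied to
  \<open>dist (f (x + t)) (f x) < e\<close> around the slice \<open>t = 0\<close>.
\<close>

lemma uniform_continuity:
  fixes f :: "'a \<Rightarrow> 'b::metric_space"
  assumes f: "continuous_on UNIV f" and "e > 0"
  obtains U where "open U" "0 \<in> U" "\<And>t x. t \<in> U \<Longrightarrow> dist (f (x + t)) (f x) < e"
proof -
  define W where "W = {z :: 'a \<times> 'a. dist (f (snd z + fst z)) (f (snd z)) < e}"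
  have "open W"
    unfolding W_def by (intro open_Collect_less continuous_intros continuous_compose[OF f])
  moreover have "{0} \<times> UNIV \<subseteq> W"
    using \<open>e > 0\<close> by (auto simp: W_def)
  ultimately obtain U where "0 \<in> U" "open U" "U \<times> UNIV \<subseteq> W"
    using Elementary_Topology.tube_lemma[OF compact_group, of W 0] by blast
  then show ?thesis
    using that[of U] unfolding W_def by fastforce
qed

lemma continuous_if_locally_close:
  fixes f :: "'a \<Rightarrow> 'b::metric_space"
  assumes "\<And>x e. e > 0 \<Longrightarrow> \<exists>U. open U \<and> 0 \<in> U \<and> (\<forall>t\<in>U. dist (f (x + t)) (f x) < e)"
  shows "continuous_on UNIV f"
proof (rule continuous_on_open_vimage[THEN iffD2, rule_format, OF open_UNIV])
  fix V :: "'b set" assume "open V"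
  show "open (f -` V \<inter> UNIV)"
    unfolding open_subopen[of "f -` V \<inter> UNIV"]
  proof
    fix x assume "x \<in> f -` V \<inter> UNIV"
    then obtain e where e: "e > 0" "ball (f x) e \<subseteq> V"
      using openE[OF \<open>open V\<close>, of "f x"] by auto
    obtain U where U: "open U" "0 \<in> U" "\<And>t. t \<in> U \<Longrightarrow> dist (f (x + t)) (f x) < e"
      using assms[OF e(1), of x] by blast
    have "open ((\<lambda>y. y - x) -` U)"
      using U by (intro open_vimage continuous_intros)
    moreover have "x \<in> (\<lambda>y. y - x) -` U" using U by simp
    moreover have "(\<lambda>y. y - x) -` U \<subseteq> f -` V \<inter> UNIV"
    proof
      fix y assume "y \<in> (\<lambda>y. y - x) -` U"
      then have "dist (f (x + (y - x))) (f x) < e" using U by blast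
      then show "y \<in> f -` V \<inter> UNIV" using e by (auto simp: dist_commute)
    qed
    ultimately show "\<exists>T. open T \<and> x \<in> T \<and> T \<subseteq> f -` V \<inter> UNIV" by blast
  qed
qed

end


section \<open>Characters of a compact abelian group\<close>

definition character :: "('a::topological_ab_group_add \<Rightarrow> complex) \<Rightarrow> bool" where
  "character \<xi> \<longleftrightarrow> continuous_on UNIV \<xi> \<and> (\<forall>x y. \<xi> (x + y) = \<xi> x * \<xi> y) \<and> (\<forall>x. norm (\<xi> x) = 1)"

lemma character_continuous: "character \<xi> \<Longrightarrow> continuous_on UNIV \<xi>"
  and character_add: "character \<xi> \<Longrightarrow> \<xi> (x + y) = \<xi> x * \<xi> y"
  and character_norm: "character \<xi> \<Longrightarrow> norm (\<xi> x) = 1"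
  by (auto simp: character_def)

lemma character_nonzero: "character \<xi> \<Longrightarrow> \<xi> x \<noteq> 0"
  using character_norm[of \<xi> x] by auto

lemma character_zero: "character \<xi> \<Longrightarrow> \<xi> 0 = 1"
  using character_add[of \<xi> 0 0] character_nonzero[of \<xi> 0] by simp

lemma character_mult_cnj: "character \<xi> \<Longrightarrow> \<xi> x * cnj (\<xi> x) = 1"
  by (simp add: complex_norm_square[symmetric] character_norm)

lemma character_minus: "character \<xi> \<Longrightarrow> \<xi> (- x) = cnj (\<xi> x)"
  using character_add[of \<xi> x "- x"] character_mult_cnj[of \<xi> x] character_nonzero[of \<xi> x] character_zero[of \<xi>]
  by (metis add.right_inverse mult_cancel_left)

lemma character_diff: "character \<xi> \<Longrightarrow> \<xi> (x - y) = \<xi> x * cnj (\<xi> y)"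
  using character_add[of \<xi> x "- y"] by (simp add: character_minus)

lemma character_one: "character (\<lambda>x. 1)"
  by (simp add: character_def)

lemma character_mult: "character \<xi> \<Longrightarrow> character \<psi> \<Longrightarrow> character (\<lambda>x. \<xi> x * \<psi> x)"
  by (auto simp: character_def norm_mult intro!: continuous_intros)

lemma character_cnj: "character \<xi> \<Longrightarrow> character (\<lambda>x. cnj (\<xi> x))"
  by (auto simp: character_def intro!: continuous_intros)

lemma character_power: "character \<xi> \<Longrightarrow> character (\<lambda>x. \<xi> x ^ n)"
  by (auto simp: character_def norm_power power_mult_distrib intro!: continuous_intros)

lemma character_prod: "(\<And>i. i \<in> I \<Longrightarrow> character (\<xi> i)) \<Longrightarrow> character (\<lambda>x. \<Prod>i\<in>I. \<xi> i x)"
  by (induction I rule: infinite_finite_induct) (auto intro: character_one character_mult)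

context compact_abelian_haar
begin

text \<open>The orthogonality relation: translating by \<open>t\<close> multiplies the integral by \<open>\<xi> t\<close>.\<close>

lemma integral_character:
  assumes "character \<xi>" "\<xi> t \<noteq> 1"
  shows "(\<integral>x. \<xi> x \<partial>\<mu>) = 0"
proof -
  have "(\<integral>x. \<xi> x \<partial>\<mu>) = (\<integral>x. \<xi> (x + t) \<partial>\<mu>)"
    using integral_translate[OF character_continuous[OF assms(1)]] by simp
  also have "\<dots> = (\<integral>x. \<xi> x \<partial>\<mu>) * \<xi> t"
    using assms by (simp add: character_add)
  finally show ?thesis using assms(2) by simp
qed

lemma integral_character_cnj:
  assumes "character \<xi>" "character \<psi>"
  shows "(\<integral>x. \<xi> x * cnj (\<psi> x) \<partial>\<mu>) = (if \<xi> = \<psi> then 1 else 0)"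
proof (cases "\<xi> = \<psi>")
  case True
  then show ?thesis using assms prob_space by (simp add: character_mult_cnj)
next
  case False
  then obtain t where "\<xi> t \<noteq> \<psi> t" by auto
  then have "\<xi> t * cnj (\<psi> t) \<noteq> 1"
    using character_mult_cnj[OF assms(2), of t] character_nonzero[OF character_cnj[OF assms(2)], of t]
    by (metis mult_cancel_right)
  then show ?thesis
    using integral_character[OF character_mult[OF assms(1) character_cnj[OF assms(2)]], of t] False by simp
qed

lemma integral_add_continuous:
  fixes f g :: "'a \<Rightarrow> 'b::{banach, second_countable_topology}"
  assumes "continuous_on UNIV f" "continuous_on UNIV g"
  shows "(\<integral>x. f x + g x \<partial>\<mu>) = (\<integral>x. f x \<partial>\<mu>) + (\<integral>x. g x \<partial>\<mu>)"
  by (intro Bochner_Integration.integral_add continuous_integrable assms)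

lemma integral_diff_continuous:
  fixes f g :: "'a \<Rightarrow> 'b::{banach, second_countable_topology}"
  assumes "continuous_on UNIV f" "continuous_on UNIV g"
  shows "(\<integral>x. f x - g x \<partial>\<mu>) = (\<integral>x. f x \<partial>\<mu>) - (\<integral>x. g x \<partial>\<mu>)"
  by (intro Bochner_Integration.integral_diff continuous_integrable assms)

definition l2norm :: "('a \<Rightarrow> complex) \<Rightarrow> real" where
  "l2norm f = sqrt (\<integral>x. (norm (f x))\<^sup>2 \<partial>\<mu>)"

lemma l2norm_nonneg: "l2norm f \<ge> 0"
  by (simp add: l2norm_def)

lemma l2norm_squared: "(l2norm f)\<^sup>2 = (\<integral>x. (norm (f x))\<^sup>2 \<partial>\<mu>)"
  by (simp add: l2norm_def)

lemma l2norm_squared_complex: "complex_of_real ((l2norm f)\<^sup>2) = (\<integral>x. f x * cnj (f x) \<partial>\<mu>)"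
  by (simp only: l2norm_squared complex_norm_square[symmetric] integral_complex_of_real)

lemma l2norm_eq_0:
  assumes "continuous_on UNIV f" "l2norm f = 0"
  shows "f x = 0"
proof -
  have 1: "(\<integral>x. (norm (f x))\<^sup>2 \<partial>\<mu>) = 0"
    using assms(2) l2norm_squared[of f] by simp
  have 2: "continuous_on UNIV (\<lambda>x. (norm (f x))\<^sup>2)"
    by (intro continuous_intros assms)
  have "(norm (f x))\<^sup>2 = 0"
    by (rule integral_nonneg_eq_0[OF 2 zero_le_power2 1])
  then show ?thesis by simp
qed

lemma l2norm_translate:
  assumes "continuous_on UNIV f"
  shows "l2norm (\<lambda>x. f (x + t)) = l2norm f"
  unfolding l2norm_def
  by (subst integral_translate[of "\<lambda>x. (norm (f x))\<^sup>2"]) (intro continuous_intros assms refl)+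

lemma l2norm_translate':
  assumes "continuous_on UNIV f"
  shows "l2norm (\<lambda>x. f (t + x)) = l2norm f"
  using l2norm_translate[OF assms, of t] by (simp add: add.commute)

lemma l2norm_cmult: "l2norm (\<lambda>x. c * f x) = norm c * l2norm f"
  by (simp add: l2norm_def norm_mult power_mult_distrib real_sqrt_mult)

lemma l2norm_cnj [simp]: "l2norm (\<lambda>x. cnj (f x)) = l2norm f"
  by (simp add: l2norm_def)

lemma l2norm_le:
  assumes "continuous_on UNIV f" "\<And>x. norm (f x) \<le> B"
  shows "l2norm f \<le> B"
proof -
  have B: "B \<ge> 0" using assms(2)[of 0] norm_ge_zero order_trans by blast
  have "(\<integral>x. (norm (f x))\<^sup>2 \<partial>\<mu>) \<le> (\<integral>x. B\<^sup>2 \<partial>\<mu>)"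
    using assms by (intro integral_mono continuous_integrable continuous_intros power_mono) auto
  also have "\<dots> = B\<^sup>2" using prob_space by simp
  finally show ?thesis
    unfolding l2norm_def using B by (simp add: real_le_lsqrt)
qed

lemma Cauchy_Schwarz:
  assumes f: "continuous_on UNIV f" and g: "continuous_on UNIV g"
  shows "norm (\<integral>x. f x * g x \<partial>\<mu>) \<le> l2norm f * l2norm g"
proof (cases "l2norm f = 0 \<or> l2norm g = 0")
  case True
  then have "(\<lambda>x. f x * g x) = (\<lambda>x. 0)"
    using l2norm_eq_0[OF f] l2norm_eq_0[OF g] by auto
  then show ?thesis by (simp add: l2norm_nonneg)
next
  case False
  define a b where "a = l2norm f" and "b = l2norm g"
  have pos: "a > 0" "b > 0" using False l2norm_nonneg[of f] l2norm_nonneg[of g] by (auto simp: a_def b_def)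
  define I where "I = (\<integral>x. norm (f x) * norm (g x) \<partial>\<mu>)"
  have "0 \<le> (\<integral>x. (b * norm (f x) - a * norm (g x))\<^sup>2 \<partial>\<mu>)"
    by (intro Bochner_Integration.integral_nonneg) simp
  also have "\<dots> = (\<integral>x. b\<^sup>2 * (norm (f x))\<^sup>2 + a\<^sup>2 * (norm (g x))\<^sup>2 - 2 * a * b * (norm (f x) * norm (g x)) \<partial>\<mu>)"
    by (simp add: power2_eq_square algebra_simps)
  also have "\<dots> = b\<^sup>2 * a\<^sup>2 + a\<^sup>2 * b\<^sup>2 - 2 * a * b * I"
  proof -
    have 1: "continuous_on UNIV (\<lambda>x. b\<^sup>2 * (norm (f x))\<^sup>2)"
      and 2: "continuous_on UNIV (\<lambda>x. a\<^sup>2 * (norm (g x))\<^sup>2)"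
      and 3: "continuous_on UNIV (\<lambda>x. 2 * a * b * (norm (f x) * norm (g x)))"
      by (intro continuous_intros f g)+
    show ?thesis
      using integral_diff_continuous[OF continuous_on_add[OF 1 2] 3] integral_add_continuous[OF 1 2]
      by (simp add: I_def a_def b_def l2norm_squared)
  qed
  finally have "a * b * I \<le> a * b * (a * b)"
    by (simp add: power2_eq_square algebra_simps)
  then have "I \<le> a * b" using pos by simp
  moreover have "norm (\<integral>x. f x * g x \<partial>\<mu>) \<le> I"
    unfolding I_def using integral_norm_bound[of \<mu> "\<lambda>x. f x * g x"] by (simp add: norm_mult)
  ultimately show ?thesis by (simp add: a_def b_def)
qed

lemma l2norm_plus_squared:
  assumes f: "continuous_on UNIV f" and g: "continuous_on UNIV g"
  shows "(l2norm (\<lambda>x. f x + g x))\<^sup>2 = (l2norm f)\<^sup>2 + (l2norm g)\<^sup>2 + 2 * Re (\<integral>x. f x * cnj (g x) \<partial>\<mu>)"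
proof -
  have "(norm (f x + g x))\<^sup>2 = (norm (f x))\<^sup>2 + (norm (g x))\<^sup>2 + 2 * Re (f x * cnj (g x))" for x
    unfolding cmod_power2 by (simp add: power2_eq_square algebra_simps)
  then have "(l2norm (\<lambda>x. f x + g x))\<^sup>2 = (\<integral>x. (norm (f x))\<^sup>2 + (norm (g x))\<^sup>2 + 2 * Re (f x * cnj (g x)) \<partial>\<mu>)"
    by (simp add: l2norm_squared)
  also have "\<dots> = (l2norm f)\<^sup>2 + (l2norm g)\<^sup>2 + 2 * (\<integral>x. Re (f x * cnj (g x)) \<partial>\<mu>)"
  proof -
    have 1: "continuous_on UNIV (\<lambda>x. (norm (f x))\<^sup>2)"
      and 2: "continuous_on UNIV (\<lambda>x. (norm (g x))\<^sup>2)"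
      and 3: "continuous_on UNIV (\<lambda>x. 2 * Re (f x * cnj (g x)))"
      by (intro continuous_intros f g)+
    show ?thesis
      using integral_add_continuous[OF continuous_on_add[OF 1 2] 3] integral_add_continuous[OF 1 2]
      by (simp only: l2norm_squared integral_mult_right_zero)
  qed
  also have "(\<integral>x. Re (f x * cnj (g x)) \<partial>\<mu>) = Re (\<integral>x. f x * cnj (g x) \<partial>\<mu>)"
    using f g by (intro integral_Re continuous_integrable continuous_intros) auto
  finally show ?thesis .
qed

lemma l2norm_parallelogram:
  assumes f: "continuous_on UNIV f" and g: "continuous_on UNIV g"
  shows "(l2norm (\<lambda>x. f x + g x))\<^sup>2 + (l2norm (\<lambda>x. f x - g x))\<^sup>2 = 2 * (l2norm f)\<^sup>2 + 2 * (l2norm g)\<^sup>2"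
proof -
  have "l2norm (\<lambda>x. - g x) = l2norm g"
    by (simp add: l2norm_def)
  moreover have "continuous_on UNIV (\<lambda>x. - g x)"
    by (intro continuous_intros g)
  ultimately show ?thesis
    using l2norm_plus_squared[OF f g] l2norm_plus_squared[OF f, of "\<lambda>x. - g x"] by simp
qed

text \<open>
  Strict convexity: equality in the triangle inequality forces proportionality. The vector
  \<open>\<parallel>b\<parallel> a - \<parallel>a\<parallel> b\<close> has norm zero.
\<close>

lemma l2norm_triangle_equality:
  assumes a: "continuous_on UNIV a" and b: "continuous_on UNIV b"
    and eq: "l2norm a + l2norm b \<le> l2norm (\<lambda>x. a x + b x)"
  shows "of_real (l2norm b) * a x = of_real (l2norm a) * b x"
proof -
  define A B where "A = l2norm a" and "B = l2norm b"
  define R where "R = Re (\<integral>x. a x * cnj (b x) \<partial>\<mu>)"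
  have AB: "A \<ge> 0" "B \<ge> 0" by (auto simp: A_def B_def l2norm_nonneg)
  have "(A + B)\<^sup>2 \<le> (l2norm (\<lambda>x. a x + b x))\<^sup>2"
    using eq AB by (intro power_mono) (auto simp: A_def B_def)
  then have "A * B \<le> R"
    using l2norm_plus_squared[OF a b] by (simp add: A_def B_def R_def power2_eq_square algebra_simps)
  define h where "h = (\<lambda>x. of_real B * a x + (- of_real A) * b x)"
  have "(l2norm h)\<^sup>2 = (l2norm (\<lambda>x. of_real B * a x))\<^sup>2 + (l2norm (\<lambda>x. (- of_real A) * b x))\<^sup>2
     + 2 * Re (\<integral>x. (of_real B * a x) * cnj ((- of_real A) * b x) \<partial>\<mu>)"
    unfolding h_def using a b by (intro l2norm_plus_squared continuous_intros)
  also have "(\<integral>x. (of_real B * a x) * cnj ((- of_real A) * b x) \<partial>\<mu>)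
      = (\<integral>x. of_real (- (A * B)) * (a x * cnj (b x)) \<partial>\<mu>)"
    by (intro Bochner_Integration.integral_cong) (auto simp: algebra_simps)
  also have "\<dots> = of_real (- (A * B)) * (\<integral>x. a x * cnj (b x) \<partial>\<mu>)"
    by (rule integral_mult_right_zero)
  also have "Re \<dots> = - (A * B) * R"
    by (simp add: R_def)
  also have "l2norm (\<lambda>x. of_real B * a x) = B * A"
    using AB l2norm_cmult[of "of_real B" a] by (simp add: A_def)
  also have "l2norm (\<lambda>x. (- of_real A) * b x) = A * B"
    using AB l2norm_cmult[of "- of_real A" b] by (simp add: B_def)
  also have "(B * A)\<^sup>2 + (A * B)\<^sup>2 + 2 * (- (A * B) * R) = 2 * (A * B) * (A * B - R)"
    by (simp add: power2_eq_square algebra_simps)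
  also have "\<dots> \<le> 0"
    using AB \<open>A * B \<le> R\<close> by (simp add: mult_nonneg_nonpos)
  finally have "l2norm h = 0" by simp
  then have "h x = 0"
    using a b unfolding h_def by (intro l2norm_eq_0[where f = h, unfolded h_def] continuous_intros)
  then show ?thesis by (simp add: h_def A_def B_def algebra_simps)
qed

text \<open>
  For functions on the group, \<open>corr f g\<close> is the convolution of \<open>f\<close> with the reflection of \<open>g\<close>.
  On Fourier coefficients it acts as a product, see \<open>corr_coefficient\<close>.
\<close>

definition corr :: "('a \<Rightarrow> complex) \<Rightarrow> ('a \<Rightarrow> complex) \<Rightarrow> 'a \<Rightarrow> complex" where
  "corr f g x = (\<integral>y. f (x + y) * g y \<partial>\<mu>)"

definition autocorr :: "('a \<Rightarrow> complex) \<Rightarrow> 'a \<Rightarrow> complex" where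
  "autocorr f = corr f (\<lambda>x. cnj (f x))"

lemma corr_bound:
  assumes f: "continuous_on UNIV f" and g: "continuous_on UNIV g"
  shows "norm (corr f g x) \<le> l2norm f * l2norm g"
proof -
  have "continuous_on UNIV (\<lambda>y. f (x + y))"
    by (intro continuous_compose[OF f] continuous_intros)
  from Cauchy_Schwarz[OF this g] show ?thesis
    by (simp add: corr_def l2norm_translate'[OF f])
qed

lemma corr_diff_translate:
  assumes f: "continuous_on UNIV f" and g: "continuous_on UNIV g"
  shows "corr f g (x + t) - corr f g x = corr (\<lambda>y. f (y + t) - f y) g x"
proof -
  have "corr f g (x + t) - corr f g x = (\<integral>y. f (x + t + y) * g y - f (x + y) * g y \<partial>\<mu>)"
    unfolding corr_def
    by (rule integral_diff_continuous[symmetric]; intro continuous_intros continuous_compose[OF f] g)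
  also have "\<dots> = corr (\<lambda>y. f (y + t) - f y) g x"
    by (simp add: corr_def left_diff_distrib add_ac)
  finally show ?thesis .
qed

lemma corr_equicontinuous:
  assumes f: "continuous_on UNIV f" and g: "continuous_on UNIV g"
    and close: "\<And>y. dist (f (y + t)) (f y) \<le> e"
  shows "dist (corr f g (x + t)) (corr f g x) \<le> e * l2norm g"
proof -
  have c: "continuous_on UNIV (\<lambda>y. f (y + t) - f y)"
    by (intro continuous_intros continuous_compose[OF f] f)
  have "dist (corr f g (x + t)) (corr f g x) \<le> l2norm (\<lambda>y. f (y + t) - f y) * l2norm g"
    using corr_bound[OF c g] corr_diff_translate[OF f g] by (simp add: dist_norm)
  also have "\<dots> \<le> e * l2norm g"
    using close by (intro mult_right_mono l2norm_le[OF c] l2norm_nonneg) (simp add: dist_norm)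
  finally show ?thesis .
qed

lemma corr_continuous:
  assumes f: "continuous_on UNIV f" and g: "continuous_on UNIV g"
  shows "continuous_on UNIV (corr f g)"
proof (rule continuous_if_locally_close)
  fix x and e :: real assume e: "e > 0"
  define e' where "e' = e / (l2norm g + 1)"
  have e': "e' > 0" using e l2norm_nonneg[of g] by (simp add: e'_def)
  obtain U where U: "open U" "0 \<in> U" "\<And>t x. t \<in> U \<Longrightarrow> dist (f (x + t)) (f x) < e'"
    using uniform_continuity[OF f e'] by blast
  have "dist (corr f g (x + t)) (corr f g x) < e" if "t \<in> U" for t
  proof -
    have "dist (corr f g (x + t)) (corr f g x) \<le> e' * l2norm g"
      using U(3)[OF that] by (intro corr_equicontinuous[OF f g] less_imp_le)
    also have "\<dots> < e"
      using e l2norm_nonneg[of g] by (simp add: e'_def field_simps)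
    finally show ?thesis .
  qed
  then show "\<exists>U. open U \<and> 0 \<in> U \<and> (\<forall>t\<in>U. dist (corr f g (x + t)) (corr f g x) < e)"
    using U by blast
qed

lemma corr_coefficient:
  assumes f: "continuous_on UNIV f" and g: "continuous_on UNIV g" and \<xi>: "character \<xi>"
  shows "(\<integral>x. corr f g x * cnj (\<xi> x) \<partial>\<mu>) = (\<integral>x. f x * cnj (\<xi> x) \<partial>\<mu>) * (\<integral>x. g x * \<xi> x \<partial>\<mu>)"
proof -
  note c = character_continuous[OF \<xi>]
  have "(\<integral>x. corr f g x * cnj (\<xi> x) \<partial>\<mu>) = (\<integral>x. \<integral>y. f (x + y) * g y * cnj (\<xi> x) \<partial>\<mu> \<partial>\<mu>)"
    by (simp add: corr_def)
  also have "\<dots> = (\<integral>y. \<integral>x. f (x + y) * g y * cnj (\<xi> x) \<partial>\<mu> \<partial>\<mu>)"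
    by (rule Fubini_continuous)
       (intro continuous_intros continuous_compose[OF f] continuous_compose[OF g] continuous_compose[OF c]
         prob_space_axioms sets_haar)+
  also have "\<dots> = (\<integral>y. g y * \<xi> y * (\<integral>x. f x * cnj (\<xi> x) \<partial>\<mu>) \<partial>\<mu>)"
  proof (rule Bochner_Integration.integral_cong[OF refl])
    fix y
    have "(\<integral>x. f (x + y) * g y * cnj (\<xi> x) \<partial>\<mu>) = (\<integral>x. g y * \<xi> y * (f (x + y) * cnj (\<xi> (x + y))) \<partial>\<mu>)"
    proof (rule Bochner_Integration.integral_cong[OF refl])
      fix x
      show "f (x + y) * g y * cnj (\<xi> x) = g y * \<xi> y * (f (x + y) * cnj (\<xi> (x + y)))"
        using character_mult_cnj[OF \<xi>, of y] by (simp add: character_add[OF \<xi>] algebra_simps)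
    qed
    also have "\<dots> = g y * \<xi> y * (\<integral>x. f (x + y) * cnj (\<xi> (x + y)) \<partial>\<mu>)"
      by simp
    also have "(\<integral>x. f (x + y) * cnj (\<xi> (x + y)) \<partial>\<mu>) = (\<integral>x. f x * cnj (\<xi> x) \<partial>\<mu>)"
      using f c by (intro integral_translate[of "\<lambda>x. f x * cnj (\<xi> x)"] continuous_intros)
    finally show "(\<integral>x. f (x + y) * g y * cnj (\<xi> x) \<partial>\<mu>) = g y * \<xi> y * (\<integral>x. f x * cnj (\<xi> x) \<partial>\<mu>)" .
  qed
  finally show ?thesis by simp
qed

lemma autocorr_continuous: "continuous_on UNIV u \<Longrightarrow> continuous_on UNIV (autocorr u)"
  unfolding autocorr_def by (intro corr_continuous continuous_intros)

lemma autocorr_bound: "continuous_on UNIV u \<Longrightarrow> norm (autocorr u x) \<le> (l2norm u)\<^sup>2"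
  unfolding autocorr_def using corr_bound[of u "\<lambda>x. cnj (u x)" x] continuous_on_cnj[of UNIV u]
  by (simp add: power2_eq_square)

lemma autocorr_zero: "autocorr u 0 = of_real ((l2norm u)\<^sup>2)"
  by (simp only: autocorr_def corr_def l2norm_squared_complex add_0)

lemma autocorr_cmult: "autocorr (\<lambda>x. c * u x) = (\<lambda>x. of_real ((norm c)\<^sup>2) * autocorr u x)"
proof
  fix x
  have "autocorr (\<lambda>x. c * u x) x = (\<integral>y. (c * cnj c) * (u (x + y) * cnj (u y)) \<partial>\<mu>)"
    unfolding autocorr_def corr_def by (intro Bochner_Integration.integral_cong) auto
  also have "\<dots> = (c * cnj c) * autocorr u x"
    by (simp add: autocorr_def corr_def)
  finally show "autocorr (\<lambda>x. c * u x) x = of_real ((norm c)\<^sup>2) * autocorr u x"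
    by (simp only: complex_norm_square)
qed

lemma autocorr_add_translate:
  assumes u: "continuous_on UNIV u" and z: "norm z = 1"
  shows "autocorr (\<lambda>x. u x + z * u (x + t)) x
    = 2 * autocorr u x + (z * autocorr u (x + t) + cnj z * autocorr u (x - t))"
proof -
  have zz: "z * cnj z = 1" using z by (simp add: complex_norm_square[symmetric])
  note uc = continuous_compose[OF u]
  have I1: "(\<integral>y. u (x + y + t) * cnj (u (y + t)) \<partial>\<mu>) = autocorr u x"
  proof -
    have "continuous_on UNIV (\<lambda>y. u (x + y) * cnj (u y))"
      by (intro continuous_intros uc)
    from integral_translate[OF this, of t] show ?thesis
      by (simp add: autocorr_def corr_def add.assoc)
  qed
  have I2: "(\<integral>y. u (x + y) * cnj (u (y + t)) \<partial>\<mu>) = autocorr u (x - t)"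
  proof -
    have "continuous_on UNIV (\<lambda>y. u (x - t + y) * cnj (u y))"
      by (intro continuous_intros uc)
    from integral_translate[OF this, of t] show ?thesis
      by (simp add: autocorr_def corr_def algebra_simps)
  qed
  have I3: "(\<integral>y. u (x + y + t) * cnj (u y) \<partial>\<mu>) = autocorr u (x + t)"
    unfolding autocorr_def corr_def by (simp add: add_ac)
  have "autocorr (\<lambda>x. u x + z * u (x + t)) x
     = (\<integral>y. (u (x + y) * cnj (u y) + u (x + y + t) * cnj (u (y + t)))
         + (z * (u (x + y + t) * cnj (u y)) + cnj z * (u (x + y) * cnj (u (y + t)))) \<partial>\<mu>)"
    unfolding autocorr_def corr_def
  proof (rule Bochner_Integration.integral_cong[OF refl])
    fix y
    have "(a + z * b) * cnj (c + z * d) = a * cnj c + (z * cnj z) * (b * cnj d) + (z * (b * cnj c) + cnj z * (a * cnj d))"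
      for a b c d by (simp add: algebra_simps)
    then show "(u (x + y) + z * u (x + y + t)) * cnj (u y + z * u (y + t)) =
         (u (x + y) * cnj (u y) + u (x + y + t) * cnj (u (y + t)))
         + (z * (u (x + y + t) * cnj (u y)) + cnj z * (u (x + y) * cnj (u (y + t))))"
      using zz by simp
  qed
  also have "\<dots> = ((\<integral>y. u (x + y) * cnj (u y) \<partial>\<mu>) + (\<integral>y. u (x + y + t) * cnj (u (y + t)) \<partial>\<mu>))
         + (z * (\<integral>y. u (x + y + t) * cnj (u y) \<partial>\<mu>) + cnj z * (\<integral>y. u (x + y) * cnj (u (y + t)) \<partial>\<mu>))"
  proof -
    have 1: "continuous_on UNIV (\<lambda>y. u (x + y) * cnj (u y))"
      and 2: "continuous_on UNIV (\<lambda>y. u (x + y + t) * cnj (u (y + t)))"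
      and 3: "continuous_on UNIV (\<lambda>y. z * (u (x + y + t) * cnj (u y)))"
      and 4: "continuous_on UNIV (\<lambda>y. cnj z * (u (x + y) * cnj (u (y + t))))"
      by (intro continuous_intros uc)+
    show ?thesis
      using integral_add_continuous[OF continuous_on_add[OF 1 2] continuous_on_add[OF 3 4]]
        integral_add_continuous[OF 1 2] integral_add_continuous[OF 3 4]
      by (simp only: integral_mult_right_zero)
  qed
  finally show ?thesis
    unfolding I1 I2 I3 by (simp add: autocorr_def corr_def)
qed

lemma l2norm_autocorr_tendsto:
  assumes un: "\<And>n. continuous_on UNIV (un n)" and u: "continuous_on UNIV u"
    and lim: "\<And>x. (\<lambda>n. un n x) \<longlonglongrightarrow> u x" and B: "\<And>n x. norm (un n x) \<le> B"
  shows "(\<lambda>n. l2norm (autocorr (un n))) \<longlonglongrightarrow> l2norm (autocorr u)"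
proof -
  have B0: "B \<ge> 0" using B[of 0 0] norm_ge_zero order_trans by blast
  have "(\<lambda>n. autocorr (un n) x) \<longlonglongrightarrow> autocorr u x" for x
    unfolding autocorr_def corr_def
  proof (rule integral_dominated_convergence[where w = "\<lambda>_. B * B"])
    show "AE y in \<mu>. norm (un n (x + y) * cnj (un n y)) \<le> B * B" for n
      using B B0 by (intro always_eventually allI) (simp add: norm_mult mult_mono')
    show "AE y in \<mu>. (\<lambda>n. un n (x + y) * cnj (un n y)) \<longlonglongrightarrow> u (x + y) * cnj (u y)"
      by (intro always_eventually allI tendsto_intros lim)
  qed (auto intro!: continuous_measurable continuous_intros continuous_compose[OF u] continuous_compose[OF un] u un)
  then have "(\<lambda>n. \<integral>x. (norm (autocorr (un n) x))\<^sup>2 \<partial>\<mu>) \<longlonglongrightarrow> (\<integral>x. (norm (autocorr u x))\<^sup>2 \<partial>\<mu>)"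
  proof (intro integral_dominated_convergence[where w = "\<lambda>_. (B\<^sup>2)\<^sup>2"] always_eventually allI)
    fix n x
    have "norm (autocorr (un n) x) \<le> (l2norm (un n))\<^sup>2" by (rule autocorr_bound[OF un])
    also have "\<dots> \<le> B\<^sup>2" using l2norm_le[OF un B] l2norm_nonneg by (intro power_mono)
    finally show "norm ((norm (autocorr (un n) x))\<^sup>2) \<le> (B\<^sup>2)\<^sup>2"
      using power_mono[of "norm (autocorr (un n) x)" "B\<^sup>2" 2] by simp
  qed (auto intro!: continuous_measurable continuous_intros autocorr_continuous u un tendsto_intros)
  then show ?thesis unfolding l2norm_def by (rule tendsto_real_sqrt)
qed

text \<open>
  The Arzela-Ascoli argument: functions \<open>corr k (\<phi> n)\<close> with \<open>\<phi> n\<close> in the unit ball share the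
  modulus of continuity of \<open>k\<close>, so convergence on a countable dense set spreads to all points.
\<close>

lemma corr_convergent_subsequence:
  assumes k: "continuous_on UNIV k" and \<phi>: "\<And>n. continuous_on UNIV (\<phi> n)" "\<And>n. l2norm (\<phi> n) \<le> 1"
  obtains r u where "strict_mono (r :: nat \<Rightarrow> nat)" "continuous_on UNIV u"
    "\<And>x. (\<lambda>n. corr k (\<phi> (r n)) x) \<longlonglongrightarrow> u x"
proof -
  define un where "un n = corr k (\<phi> n)" for n
  have bound: "norm (un n x) \<le> l2norm k" for n x
  proof -
    have "norm (un n x) \<le> l2norm k * l2norm (\<phi> n)"
      unfolding un_def by (rule corr_bound[OF k \<phi>(1)])
    also have "\<dots> \<le> l2norm k * 1" by (intro mult_left_mono \<phi> l2norm_nonneg)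
    finally show ?thesis by simp
  qed
  have equi: "\<exists>U. open U \<and> 0 \<in> U \<and> (\<forall>t\<in>U. \<forall>n x. dist (un n (x + t)) (un n x) \<le> e)" if e0: "e > 0" for e
  proof -
    obtain U where U: "open U" "0 \<in> U" "\<And>t x. t \<in> U \<Longrightarrow> dist (k (x + t)) (k x) < e"
      using uniform_continuity[OF k e0] by blast
    have "dist (un n (x + t)) (un n x) \<le> e" if "t \<in> U" for t n x
    proof -
      have "dist (un n (x + t)) (un n x) \<le> e * l2norm (\<phi> n)"
        unfolding un_def using U(3)[OF that] by (intro corr_equicontinuous[OF k \<phi>(1)] less_imp_le)
      also have "\<dots> \<le> e * 1" using \<open>e > 0\<close> by (intro mult_left_mono \<phi>) auto
      finally show ?thesis by simp
    qed
    then show ?thesis using U by blast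
  qed
  obtain \<B> :: "'a set set" where \<B>: "countable \<B>" "\<And>B. B \<in> \<B> \<Longrightarrow> open B"
    "\<And>W x. open W \<Longrightarrow> x \<in> W \<Longrightarrow> \<exists>B\<in>\<B>. x \<in> B \<and> B \<subseteq> W"
    using countable_base by blast
  define S where "S = (\<lambda>B. SOME x. x \<in> B) ` \<B>"
  have "countable S" unfolding S_def using \<B>(1) by simp
  have dense: "\<exists>s\<in>S. s \<in> W" if W: "open W" "x \<in> W" for W x
  proof -
    obtain B where B: "B \<in> \<B>" "x \<in> B" "B \<subseteq> W" using \<B>(3)[OF W] by blast
    then have "(SOME x. x \<in> B) \<in> W" using someI[of "\<lambda>x. x \<in> B" x] by blast
    then show ?thesis using B(1) unfolding S_def by blast
  qed
  obtain r where r: "strict_mono (r :: nat \<Rightarrow> nat)" "\<And>x. x \<in> S \<Longrightarrow> \<exists>l. (\<lambda>n. un (r n) x) \<longlonglongrightarrow> l"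
    using function_convergent_subsequence[of S un "l2norm k"] \<open>countable S\<close> bound by blast
  have "\<exists>l. (\<lambda>n. un (r n) x) \<longlonglongrightarrow> l" for x
  proof -
    have "Cauchy (\<lambda>n. un (r n) x)"
    proof (rule metric_CauchyI)
      fix e :: real assume e: "e > 0"
      obtain U where U: "open U" "0 \<in> U" "\<And>t n x. t \<in> U \<Longrightarrow> dist (un n (x + t)) (un n x) \<le> e / 4"
        using equi[of "e / 4"] e by auto
      have "open ((\<lambda>y. y - x) -` U)"
        using U by (intro open_vimage continuous_intros)
      then obtain s where s: "s \<in> S" "s - x \<in> U"
        using dense[of "(\<lambda>y. y - x) -` U" x] U by auto
      have near: "dist (un n s) (un n x) \<le> e / 4" for n
        using U(3)[OF s(2), of n x] by simp
      have "Cauchy (\<lambda>n. un (r n) s)"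
        using r(2)[OF s(1)] LIMSEQ_imp_Cauchy by blast
      then obtain N where N: "\<And>m n. m \<ge> N \<Longrightarrow> n \<ge> N \<Longrightarrow> dist (un (r m) s) (un (r n) s) < e / 4"
        using e unfolding Cauchy_def by (metis divide_pos_pos zero_less_numeral)
      show "\<exists>N. \<forall>m\<ge>N. \<forall>n\<ge>N. dist (un (r m) x) (un (r n) x) < e"
      proof (intro exI allI impI)
        fix m n assume mn: "N \<le> m" "N \<le> n"
        have "dist (un (r m) x) (un (r n) x)
            \<le> dist (un (r m) s) (un (r m) x) + dist (un (r m) s) (un (r n) s) + dist (un (r n) s) (un (r n) x)"
          using dist_triangle[of "un (r m) x" "un (r n) x" "un (r m) s"]
            dist_triangle[of "un (r m) s" "un (r n) x" "un (r n) s"] by (simp add: dist_commute)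
        then show "dist (un (r m) x) (un (r n) x) < e"
          using near[of "r m"] near[of "r n"] N[OF mn] e by linarith
      qed
    qed
    then show ?thesis using Cauchy_convergent_iff convergent_def by blast
  qed
  then obtain u where u: "\<And>x. (\<lambda>n. un (r n) x) \<longlonglongrightarrow> u x" by metis
  have "continuous_on UNIV u"
  proof (rule continuous_if_locally_close)
    fix x and e :: real assume e: "e > 0"
    obtain U where U: "open U" "0 \<in> U" "\<And>t n x. t \<in> U \<Longrightarrow> dist (un n (x + t)) (un n x) \<le> e / 2"
      using equi[of "e / 2"] e by auto
    have "dist (u (x + t)) (u x) < e" if "t \<in> U" for t
    proof -
      have "(\<lambda>n. dist (un (r n) (x + t)) (un (r n) x)) \<longlonglongrightarrow> dist (u (x + t)) (u x)"
        by (intro tendsto_intros u)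
      then have "dist (u (x + t)) (u x) \<le> e / 2"
        using U(3)[OF that] by (intro LIMSEQ_le_const2) auto
      then show ?thesis using e by simp
    qed
    then show "\<exists>U. open U \<and> 0 \<in> U \<and> (\<forall>t\<in>U. dist (u (x + t)) (u x) < e)"
      using U by blast
  qed
  then show ?thesis using that[OF r(1)] u by (simp add: un_def)
qed

end


context compact_abelian_haar
begin

lemma bounded_tendsto_integral:
  assumes fn: "\<And>n. continuous_on UNIV (fn n)" and f: "continuous_on UNIV f"
    and lim: "\<And>x. (\<lambda>n. fn n x) \<longlonglongrightarrow> f x" and B: "\<And>n x. norm (fn n x) \<le> B"
  shows "(\<lambda>n. \<integral>x. fn n x \<partial>\<mu>) \<longlonglongrightarrow> (\<integral>x. f x \<partial>\<mu> :: complex)"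
  by (rule integral_dominated_convergence[where w = "\<lambda>_. B"])
     (use B lim in \<open>auto intro: continuous_measurable f fn\<close>)

lemma corr_add_translate:
  assumes k: "continuous_on UNIV k" and \<phi>: "continuous_on UNIV \<phi>"
  shows "corr k \<phi> x + z * corr k \<phi> (x + t) = corr k (\<lambda>y. \<phi> y + z * \<phi> (y - t)) x"
proof -
  have c: "continuous_on UNIV (\<lambda>y. k (x + y) * (z * \<phi> (y - t)))"
    by (intro continuous_intros continuous_compose[OF k] continuous_compose[OF \<phi>])
  have c0: "continuous_on UNIV (\<lambda>y. k (x + y) * \<phi> y)"
    by (intro continuous_intros continuous_compose[OF k] \<phi>)
  have "(\<integral>y. k (x + y) * (z * \<phi> (y - t)) \<partial>\<mu>) = (\<integral>y. z * (k (x + t + y) * \<phi> y) \<partial>\<mu>)"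
    using integral_translate[OF c, of t, symmetric] by (simp add: algebra_simps)
  also have "\<dots> = z * corr k \<phi> (x + t)"
    by (simp add: corr_def)
  finally show ?thesis
    using integral_add_continuous[OF c0 c] by (simp add: corr_def distrib_left)
qed

text \<open>
  Completeness of the characters. Correlation multiplies Fourier coefficients, so those of
  \<open>autocorr (corr k \<phi>)\<close> are the products of the squared moduli of coefficients of \<open>k\<close> and \<open>\<phi>\<close>. Over
  the unit ball the norm of this function should be maximal when \<open>\<phi>\<close> is concentrated on a single
  character. The proof turns this around. By compactness of the correlation with \<open>k\<close> there is a
  maximizing limit \<open>v\<close>. Replacing \<open>\<phi>\<close> by \<open>\<phi> + z \<phi>'\<close> and \<open>\<phi> - z \<phi>'\<close>, with \<open>\<phi>'\<close> a translate of \<open>\<phi>\<close> and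
  \<open>\<bar>z\<bar> = 1\<close>, writes \<open>4 v\<close> as a sum of two functions. By maximality and the parallelogram law their
  norms add up to at most \<open>4 \<parallel>v\<parallel>\<close>, so by strict convexity both are proportional to \<open>v\<close>. Varying \<open>z\<close>, every
  translate of \<open>v\<close> is a multiple of \<open>v\<close>, which makes \<open>v\<close> a multiple of a character.
\<close>

theorem nonzero_coefficient:
  assumes k: "continuous_on UNIV k" and nz: "k x0 \<noteq> 0"
  obtains \<xi> where "character \<xi>" "(\<integral>x. k x * cnj (\<xi> x) \<partial>\<mu>) \<noteq> 0"
proof -
  define G where "G \<phi> = l2norm (autocorr (corr k \<phi>))" for \<phi>
  define \<Phi> where "\<Phi> = {\<phi>. continuous_on UNIV \<phi> \<and> l2norm \<phi> \<le> 1}"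
  define M where "M = Sup (G ` \<Phi>)"
  have corr_le: "norm (corr k \<phi> x) \<le> l2norm k" if "\<phi> \<in> \<Phi>" for \<phi> x
  proof -
    have "norm (corr k \<phi> x) \<le> l2norm k * l2norm \<phi>"
      using that k by (intro corr_bound) (auto simp: \<Phi>_def)
    also have "\<dots> \<le> l2norm k * 1"
      using that by (intro mult_left_mono l2norm_nonneg) (auto simp: \<Phi>_def)
    finally show ?thesis by simp
  qed
  have cc: "continuous_on UNIV (corr k \<phi>)" if "\<phi> \<in> \<Phi>" for \<phi>
    using that k by (intro corr_continuous) (auto simp: \<Phi>_def)
  have G_le: "G \<phi> \<le> (l2norm k)\<^sup>2" if "\<phi> \<in> \<Phi>" for \<phi>
    unfolding G_def
  proof (rule l2norm_le[OF autocorr_continuous[OF cc[OF that]]])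
    fix x
    have "norm (autocorr (corr k \<phi>) x) \<le> (l2norm (corr k \<phi>))\<^sup>2"
      by (rule autocorr_bound[OF cc[OF that]])
    also have "\<dots> \<le> (l2norm k)\<^sup>2"
      by (intro power_mono l2norm_le cc[OF that] corr_le[OF that] l2norm_nonneg)
    finally show "norm (autocorr (corr k \<phi>) x) \<le> (l2norm k)\<^sup>2" .
  qed
  have bdd: "bdd_above (G ` \<Phi>)"
    using G_le by (auto simp: bdd_above_def)
  have "(\<lambda>x. 0) \<in> \<Phi>" by (simp add: \<Phi>_def l2norm_def)
  have G_M: "G \<phi> \<le> M" if "\<phi> \<in> \<Phi>" for \<phi>
    unfolding M_def using that bdd by (intro cSup_upper) auto
  have G_hom: "G \<phi> \<le> M * (l2norm \<phi>)\<^sup>2" if \<phi>: "continuous_on UNIV \<phi>" for \<phi>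
  proof (cases "l2norm \<phi> = 0")
    case True
    then have "\<phi> = (\<lambda>x. 0)" using l2norm_eq_0[OF \<phi>] by auto
    then show ?thesis by (simp add: G_def autocorr_def corr_def[abs_def] l2norm_def)
  next
    case False
    define s where "s = l2norm \<phi>"
    have s: "s > 0" using False l2norm_nonneg[of \<phi>] by (simp add: s_def)
    define \<psi> where "\<psi> = (\<lambda>x. complex_of_real (1 / s) * \<phi> x)"
    have "l2norm \<psi> = 1" using s l2norm_cmult[of "complex_of_real (1 / s)" \<phi>]
      by (simp add: \<psi>_def s_def norm_divide del: of_real_divide)
    moreover have "continuous_on UNIV \<psi>"
      unfolding \<psi>_def by (intro continuous_intros \<phi>)
    ultimately have "G \<psi> \<le> M" by (intro G_M) (simp add: \<Phi>_def)
    have "\<phi> = (\<lambda>x. of_real s * \<psi> x)" using s by (auto simp: \<psi>_def)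
    then have "corr k \<phi> = (\<lambda>x. of_real s * corr k \<psi> x)"
      by (simp add: corr_def[abs_def] mult.left_commute[of _ "of_real s"])
    then have "G \<phi> = s\<^sup>2 * G \<psi>"
      unfolding G_def using l2norm_cmult[of "of_real (s\<^sup>2)" "autocorr (corr k \<psi>)"]
      by (simp add: autocorr_cmult norm_power)
    also have "\<dots> \<le> s\<^sup>2 * M"
      using \<open>G \<psi> \<le> M\<close> by (intro mult_left_mono) auto
    finally show ?thesis by (simp add: s_def mult.commute)
  qed
  have M_pos: "M > 0"
  proof (rule ccontr)
    assume "\<not> M > 0"
    have \<phi>: "continuous_on UNIV (\<lambda>x. cnj (k x))" by (intro continuous_intros k)
    have "G (\<lambda>x. cnj (k x)) \<le> 0"
      using G_hom[OF \<phi>] \<open>\<not> M > 0\<close> by (smt (verit) mult_nonpos_nonneg zero_le_power2)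
    then have "l2norm (autocorr (autocorr k)) = 0"
      using l2norm_nonneg by (simp add: G_def autocorr_def order_antisym)
    then have "autocorr (autocorr k) 0 = 0"
      by (intro l2norm_eq_0 autocorr_continuous k)
    then have "l2norm (autocorr k) = 0" by (simp add: autocorr_zero)
    then have "autocorr k 0 = 0" by (intro l2norm_eq_0 autocorr_continuous k)
    then have "l2norm k = 0" by (simp add: autocorr_zero)
    then show False using nz l2norm_eq_0[OF k] by simp
  qed
  have "\<exists>\<phi>\<in>\<Phi>. M - 1 / Suc n < G \<phi>" for n
    using less_cSupD[of "G ` \<Phi>" "M - 1 / Suc n"] \<open>(\<lambda>x. 0) \<in> \<Phi>\<close> unfolding M_def by auto
  then obtain \<phi> where \<phi>: "\<And>n. \<phi> n \<in> \<Phi>" "\<And>n. M - 1 / Suc n < G (\<phi> n)"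
    by metis
  have \<phi>c: "continuous_on UNIV (\<phi> n)" and \<phi>1: "l2norm (\<phi> n) \<le> 1" for n
    using \<phi>(1) by (auto simp: \<Phi>_def)
  have G_lim: "(\<lambda>n. G (\<phi> n)) \<longlonglongrightarrow> M"
  proof (rule tendsto_sandwich)
    show "\<forall>\<^sub>F n in sequentially. M - 1 / Suc n \<le> G (\<phi> n)"
      using \<phi>(2) by (intro always_eventually) (simp add: less_imp_le)
    show "\<forall>\<^sub>F n in sequentially. G (\<phi> n) \<le> M"
      using \<phi>(1) G_M by (intro always_eventually) simp
    have "(\<lambda>n. M - 1 / Suc n) \<longlonglongrightarrow> M - 0"
      by (intro tendsto_diff tendsto_const LIMSEQ_Suc[OF lim_1_over_n])
    then show "(\<lambda>n. M - 1 / Suc n) \<longlonglongrightarrow> M" by simp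
  qed simp
  obtain r u where r: "strict_mono (r :: nat \<Rightarrow> nat)" and u: "continuous_on UNIV u"
    and lim: "\<And>x. (\<lambda>n. corr k (\<phi> (r n)) x) \<longlonglongrightarrow> u x"
    by (rule corr_convergent_subsequence[where \<phi> = \<phi>, OF k \<phi>c \<phi>1]) (rule that)
  define un where "un n = corr k (\<phi> (r n))" for n
  have unc: "continuous_on UNIV (un n)" and un_le: "norm (un n x) \<le> l2norm k" for n x
    unfolding un_def using cc corr_le \<phi>(1) by auto
  have limu: "(\<lambda>n. un n x) \<longlonglongrightarrow> u x" for x
    using lim by (simp add: un_def)
  define v where "v = autocorr u"
  have v: "continuous_on UNIV v"
    unfolding v_def by (intro autocorr_continuous u)
  have v_norm: "l2norm v = M"
  proof -
    have "(\<lambda>n. l2norm (autocorr (un n))) \<longlonglongrightarrow> l2norm v"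
      unfolding v_def by (intro l2norm_autocorr_tendsto[OF unc u limu un_le])
    moreover have "(\<lambda>n. l2norm (autocorr (un n))) \<longlonglongrightarrow> M"
      using LIMSEQ_subseq_LIMSEQ[OF G_lim r] by (simp add: un_def G_def o_def)
    ultimately show ?thesis using LIMSEQ_unique by blast
  qed
  have translate: "\<exists>c. \<forall>x. z * v (x + t) + cnj z * v (x - t) = c * v x" if z: "norm z = 1" for z t
  proof -
    define P where "P s f = (\<lambda>x :: 'a. f x + s * f (x + t))" for s and f :: "'a \<Rightarrow> complex"
    have Pc: "continuous_on UNIV (P s f)" if "continuous_on UNIV f" for s f
      unfolding P_def by (intro continuous_intros continuous_compose[OF that] that)
    have AP: "autocorr (P s u) x = 2 * v x + (s * v (x + t) + cnj s * v (x - t))"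
      if "norm s = 1" for s x
      unfolding P_def v_def by (rule autocorr_add_translate[OF u that])
    define a b where "a = autocorr (P z u)" and "b = autocorr (P (- z) u)"
    have ab_c: "continuous_on UNIV a" "continuous_on UNIV b"
      unfolding a_def b_def by (intro autocorr_continuous Pc u)+
    have ab: "a x + b x = 4 * v x" for x
      unfolding a_def b_def using z AP[of z x] AP[of "- z" x] by simp
    have Plim: "(\<lambda>n. l2norm (autocorr (P s (un n)))) \<longlonglongrightarrow> l2norm (autocorr (P s u))" if "norm s = 1" for s
    proof (rule l2norm_autocorr_tendsto)
      show "(\<lambda>n. P s (un n) x) \<longlonglongrightarrow> P s u x" for x
        unfolding P_def by (intro tendsto_intros limu)
      show "norm (P s (un n) x) \<le> l2norm k + l2norm k" for n x
      proof -
        have "norm (P s (un n) x) \<le> norm (un n x) + norm (s * un n (x + t))"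
          unfolding P_def by (rule norm_triangle_ineq)
        then show ?thesis
          using un_le[of n x] un_le[of n "x + t"] that by (simp add: norm_mult)
      qed
    qed (intro Pc unc u)+
    \<comment> \<open>Correlation with \<open>k\<close> commutes with translations, so both parts come from competitors.\<close>
    have sum_le: "l2norm (autocorr (P z (un n))) + l2norm (autocorr (P (- z) (un n))) \<le> 4 * M" for n
    proof -
      define g where "g = \<phi> (r n)"
      have g: "continuous_on UNIV g" "l2norm g \<le> 1" unfolding g_def by (rule \<phi>c, rule \<phi>1)
      define g' where "g' = (\<lambda>y. z * g (y - t))"
      have g': "continuous_on UNIV g'"
        unfolding g'_def by (intro continuous_intros continuous_compose[OF g(1)])
      have "l2norm g' = l2norm g"
        using z l2norm_translate[OF g(1), of "- t"] l2norm_cmult[of z "\<lambda>y. g (y - t)"] by (simp add: g'_def)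
      have 1: "P z (un n) = corr k (\<lambda>y. g y + g' y)"
        unfolding P_def un_def g'_def using corr_add_translate[OF k g(1), of _ z t] by (simp add: g_def)
      have 2: "P (- z) (un n) = corr k (\<lambda>y. g y - g' y)"
        unfolding P_def un_def g'_def using corr_add_translate[OF k g(1), of _ "- z" t] by (simp add: g_def)
      have "l2norm (autocorr (P z (un n))) + l2norm (autocorr (P (- z) (un n)))
          \<le> M * (l2norm (\<lambda>y. g y + g' y))\<^sup>2 + M * (l2norm (\<lambda>y. g y - g' y))\<^sup>2"
        unfolding 1 2 using g g' by (intro add_mono G_hom[unfolded G_def] continuous_intros)
      also have "\<dots> = M * (4 * (l2norm g)\<^sup>2)"
        using l2norm_parallelogram[OF g(1) g'] by (simp add: \<open>l2norm g' = l2norm g\<close> distrib_left[symmetric])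
      also have "\<dots> \<le> M * (4 * 1)"
        using g(2) M_pos l2norm_nonneg[of g] by (intro mult_left_mono) (auto simp: power_le_one)
      finally show ?thesis by simp
    qed
    have "l2norm a + l2norm b \<le> 4 * M"
      unfolding a_def b_def using sum_le z by (intro LIMSEQ_le_const2[OF tendsto_add[OF Plim Plim]]) auto
    also have "4 * M = l2norm (\<lambda>x. a x + b x)"
      using l2norm_cmult[of 4 v] by (simp add: ab v_norm)
    finally have tri: "l2norm a + l2norm b \<le> l2norm (\<lambda>x. a x + b x)" .
    have proportional: "of_real (l2norm b) * a x = of_real (l2norm a) * b x" for x
      by (rule l2norm_triangle_equality[OF ab_c tri])
    have pos: "l2norm a + l2norm b > 0"
    proof (rule ccontr)
      assume "\<not> l2norm a + l2norm b > 0"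
      then have "l2norm a = 0" "l2norm b = 0"
        using l2norm_nonneg[of a] l2norm_nonneg[of b] by linarith+
      then have "a x = 0" "b x = 0" for x
        using l2norm_eq_0[OF ab_c(1)] l2norm_eq_0[OF ab_c(2)] by blast+
      then have "v x = 0" for x
        using ab[of x] by simp
      then have "l2norm v = 0" by (simp add: l2norm_def)
      then show False using M_pos v_norm by simp
    qed
    have a_v: "a x = of_real (4 * l2norm a / (l2norm a + l2norm b)) * v x" for x
    proof -
      define A B where "A = l2norm a" and "B = l2norm b"
      have "of_real (A + B) * a x = of_real A * a x + of_real B * a x"
        by (simp add: distrib_right)
      also have "\<dots> = of_real A * (4 * v x)"
        using proportional[of x] by (simp add: A_def B_def ab[symmetric] distrib_left)
      finally have "a x = of_real A * (4 * v x) / of_real (A + B)"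
        using pos by (metis A_def B_def less_irrefl nonzero_mult_div_cancel_left of_real_eq_0_iff)
      then show ?thesis by (simp add: A_def B_def)
    qed
    define c where "c = of_real (4 * l2norm a / (l2norm a + l2norm b)) - (2 :: complex)"
    have "z * v (x + t) + cnj z * v (x - t) = c * v x" for x
      using AP[OF z, of x] a_v[of x] unfolding a_def[symmetric] by (simp add: c_def algebra_simps)
    then show ?thesis by blast
  qed
  have eigen: "\<exists>c. \<forall>x. v (x + t) = c * v x" for t
  proof -
    obtain c1 c2 where c: "\<And>x. v (x + t) + v (x - t) = c1 * v x" "\<And>x. \<i> * v (x + t) - \<i> * v (x - t) = c2 * v x"
      using translate[of 1 t] translate[of \<i> t] by auto
    have "v (x + t) = (c1 - \<i> * c2) / 2 * v x" for x
    proof -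
      have "(c1 - \<i> * c2) * v x = c1 * v x - \<i> * (c2 * v x)" by (simp add: algebra_simps)
      also have "\<dots> = 2 * v (x + t)"
        unfolding c[symmetric] by (simp add: algebra_simps)
      finally show ?thesis by simp
    qed
    then show ?thesis by blast
  qed
  have v0: "v 0 = of_real ((l2norm u)\<^sup>2)" by (simp only: v_def autocorr_zero)
  have v_le: "norm (v x) \<le> norm (v 0)" for x
    using autocorr_bound[OF u, of x] by (simp add: v_def autocorr_zero norm_power)
  have v0_nz: "v 0 \<noteq> 0"
  proof
    assume "v 0 = 0"
    then have "v = (\<lambda>x. 0)" using v_le by auto
    then show False using v_norm M_pos by (simp add: l2norm_def)
  qed
  define \<xi> where "\<xi> x = v x / v 0" for x
  have v_xi: "v x = v 0 * \<xi> x" for x using v0_nz by (simp add: \<xi>_def)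
  have mult: "\<xi> (x + t) = \<xi> x * \<xi> t" for x t
  proof -
    obtain c where "\<And>x. v (x + t) = c * v x" using eigen by blast
    from this[of x] this[of 0] show ?thesis using v0_nz by (simp add: \<xi>_def)
  qed
  have \<xi>_le: "norm (\<xi> x) \<le> 1" for x using v_le[of x] v0_nz by (simp add: \<xi>_def norm_divide)
  have \<xi>: "character \<xi>"
    unfolding character_def
  proof (intro conjI allI)
    show "continuous_on UNIV \<xi>" unfolding \<xi>_def using v0_nz by (intro continuous_intros v) auto
    show "\<xi> (x + y) = \<xi> x * \<xi> y" for x y by (rule mult)
    show "norm (\<xi> x) = 1" for x
    proof -
      have "\<xi> x * \<xi> (- x) = 1" using mult[of x "- x"] v0_nz by (simp add: \<xi>_def)
      then have "norm (\<xi> x) * norm (\<xi> (- x)) = 1" by (metis norm_mult norm_one)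
      moreover have "norm (\<xi> x) * norm (\<xi> (- x)) \<le> norm (\<xi> x) * 1"
        using \<xi>_le[of "- x"] by (intro mult_left_mono) auto
      ultimately show ?thesis using \<xi>_le[of x] by simp
    qed
  qed
  note \<xi>c = character_continuous[OF \<xi>]
  \<comment> \<open>The coefficient of \<open>v\<close> at \<open>\<xi>\<close> is \<open>v 0\<close>, and it factors through those of \<open>u\<close> and of \<open>k\<close>.\<close>
  have "(\<integral>x. v x * cnj (\<xi> x) \<partial>\<mu>) = v 0"
  proof -
    have "v x * cnj (\<xi> x) = v 0" for x
      using v_xi[of x] character_mult_cnj[OF \<xi>, of x] by (simp add: mult.assoc)
    then show ?thesis using prob_space by simp
  qed
  then have u_coeff: "(\<integral>x. u x * cnj (\<xi> x) \<partial>\<mu>) \<noteq> 0"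
    using v0_nz corr_coefficient[OF u continuous_on_cnj[OF u] \<xi>] by (auto simp: v_def autocorr_def)
  have "(\<integral>x. k x * cnj (\<xi> x) \<partial>\<mu>) \<noteq> 0"
  proof
    assume 0: "(\<integral>x. k x * cnj (\<xi> x) \<partial>\<mu>) = 0"
    have "(\<integral>x. un n x * cnj (\<xi> x) \<partial>\<mu>) = 0" for n
      unfolding un_def using corr_coefficient[OF k \<phi>c \<xi>] 0 by simp
    moreover have "(\<lambda>n. \<integral>x. un n x * cnj (\<xi> x) \<partial>\<mu>) \<longlonglongrightarrow> (\<integral>x. u x * cnj (\<xi> x) \<partial>\<mu>)"
    proof (rule bounded_tendsto_integral)
      show "norm (un n x * cnj (\<xi> x)) \<le> l2norm k" for n x
        using un_le by (simp add: norm_mult character_norm[OF \<xi>])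
      show "(\<lambda>n. un n x * cnj (\<xi> x)) \<longlonglongrightarrow> u x * cnj (\<xi> x)" for x
        by (intro tendsto_intros limu)
    qed (intro continuous_intros unc u \<xi>c)+
    ultimately show False using u_coeff by (simp add: LIMSEQ_const_iff)
  qed
  then show ?thesis using that \<xi> by blast
qed

text \<open>
  If \<open>f\<close> takes different values at \<open>a\<close> and \<open>0\<close>, then \<open>f (x + a) - f x\<close> is not identically zero, but
  its coefficients vanish at all characters that are trivial on \<open>a\<close>.
\<close>

corollary character_separates:
  fixes a :: 'a
  assumes "a \<noteq> 0"
  obtains \<xi> where "character \<xi>" "\<xi> a \<noteq> 1"
proof -
  obtain f :: "'a \<Rightarrow> real" where f: "continuous_on UNIV f" "f a \<noteq> f 0"
    using continuous_separates[OF assms] by blast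
  define g where "g = (\<lambda>x. complex_of_real (f x))"
  have g: "continuous_on UNIV g" unfolding g_def by (intro continuous_intros f)
  define k where "k = (\<lambda>x. g (x + a) - g x)"
  have k: "continuous_on UNIV k"
    unfolding k_def by (intro continuous_intros continuous_compose[OF g] g)
  have "k 0 \<noteq> 0" using f by (simp add: k_def g_def)
  then obtain \<xi> where \<xi>: "character \<xi>" "(\<integral>x. k x * cnj (\<xi> x) \<partial>\<mu>) \<noteq> 0"
    using nonzero_coefficient[OF k] by blast
  have "\<xi> a \<noteq> 1"
  proof
    assume "\<xi> a = 1"
    then have per: "\<xi> (x + a) = \<xi> x" for x by (simp add: character_add[OF \<xi>(1)])
    have c: "continuous_on UNIV (\<lambda>x. g x * cnj (\<xi> x))"
      by (intro continuous_intros g character_continuous \<xi>)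
    have c': "continuous_on UNIV (\<lambda>x. g (x + a) * cnj (\<xi> x))"
      by (intro continuous_intros continuous_compose[OF g] character_continuous \<xi>)
    have "(\<integral>x. k x * cnj (\<xi> x) \<partial>\<mu>) = 0"
      using integral_translate[OF c, of a] integral_diff_continuous[OF c' c]
      by (simp add: per k_def left_diff_distrib)
    then show False using \<xi>(2) by simp
  qed
  then show ?thesis using that \<xi>(1) by blast
qed

end


section \<open>Circle-valued functions on a connected group\<close>

locale connected_abelian_haar = compact_abelian_haar \<mu>
  for \<mu> :: "'a::topological_ab_group_add measure" +
  assumes connected_group: "connected (UNIV :: 'a set)"
begin

lemma constant_if_cis_constant:
  fixes L :: "'a \<Rightarrow> real"
  assumes L: "continuous_on UNIV L" and c: "\<And>x. cis (L x) = c"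
  shows "L x = L y"
proof -
  have "L constant_on UNIV"
  proof (rule continuous_discrete_range_constant[OF connected_group L])
    fix x
    show "\<exists>e>0. \<forall>y. y \<in> UNIV \<and> L y \<noteq> L x \<longrightarrow> e \<le> norm (L y - L x)"
    proof (intro exI[of _ "2 * pi"] conjI allI impI)
      fix y assume ne: "y \<in> UNIV \<and> L y \<noteq> L x"
      have "exp (\<i> * of_real (L y)) = exp (\<i> * of_real (L x))"
        using c[of x] c[of y] by (simp add: cis_conv_exp)
      then obtain n :: int where n: "\<i> * of_real (L y) = \<i> * of_real (L x) + (of_int (2 * n) * pi) * \<i>"
        using exp_eq by blast
      then have "complex_of_real (L y) = of_real (L x + of_int (2 * n) * pi)"
        by (simp add: algebra_simps) (metis complex_i_not_zero distrib_left mult_left_cancel)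
      then have eq: "L y - L x = of_int (2 * n) * pi"
        unfolding of_real_eq_iff by simp
      then have "n \<noteq> 0" using ne by auto
      then have "1 \<le> \<bar>real_of_int n\<bar>" by linarith
      then have "2 * pi * 1 \<le> 2 * pi * \<bar>real_of_int n\<bar>" by (intro mult_left_mono) auto
      then show "2 * pi \<le> norm (L y - L x)"
        using eq by (simp add: abs_mult mult_ac)
    qed simp
  qed
  then show ?thesis by (auto simp: constant_on_def)
qed

text \<open>
  The logarithm is additive by connectedness and bounded by compactness. In particular, no
  nontrivial character has a continuous logarithm.
\<close>

lemma additive_logarithm_zero:
  fixes L :: "'a \<Rightarrow> real"
  assumes L: "continuous_on UNIV L" "L 0 = 0" and mult: "\<And>x y. cis (L (x + y)) = cis (L x) * cis (L y)"
  shows "L x = 0"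
proof -
  have add: "L (x + y) = L x + L y" for x y
  proof -
    have "continuous_on UNIV (\<lambda>x. L (x + y) - L x)"
      by (intro continuous_intros continuous_compose[OF L(1)] L)
    moreover have "cis (L (x + y) - L x) = cis (L y)" for x
      by (simp add: cis_divide[symmetric] mult)
    ultimately have "L (x + y) - L x = L (0 + y) - L 0"
      by (rule constant_if_cis_constant)
    then show ?thesis using L(2) by simp
  qed
  obtain B where B: "B > 0" "\<And>x. norm (L x) \<le> B"
    using continuous_bounded[OF L(1)] by blast
  have "\<bar>L x\<bar> \<le> B / 2 ^ n" for n x
  proof (induction n arbitrary: x)
    case 0
    then show ?case using B by simp
  next
    case (Suc n)
    have "2 * \<bar>L x\<bar> = \<bar>L (x + x)\<bar>" by (simp add: add)
    also have "\<dots> \<le> B / 2 ^ n" by (rule Suc)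
    finally show ?case by (simp add: field_simps)
  qed
  moreover have "(\<lambda>n. B / 2 ^ n) \<longlonglongrightarrow> 0"
    using LIMSEQ_divide_realpow_zero[of 2 B] by simp
  ultimately have "\<bar>L x\<bar> \<le> 0"
    by (intro LIMSEQ_le_const[of "\<lambda>n. B / 2 ^ n"]) auto
  then show ?thesis by simp
qed

lemma small_logarithms:
  fixes g :: "'a \<Rightarrow> complex"
  assumes g: "continuous_on UNIV g" "\<And>x. norm (g x) = 1" and e: "e > (0::real)"
  obtains U where "open U" "0 \<in> U"
    "\<And>t. t \<in> U \<Longrightarrow> \<exists>H. continuous_on UNIV H \<and> (\<forall>x. g (x + t) = g x * cis (H x)) \<and> (\<forall>x. \<bar>H x\<bar> \<le> e)"
proof -
  have "isCont (\<lambda>w. Im (Ln w)) 1"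
    by (rule isCont_Im[OF continuous_at_Ln]) auto
  then obtain d where d: "d > 0" "\<And>w. dist w 1 < d \<Longrightarrow> \<bar>Im (Ln w)\<bar> < e"
    using e unfolding continuous_at_eps_delta by (auto simp: dist_real_def)
  obtain U where U: "open U" "0 \<in> U" "\<And>t x. t \<in> U \<Longrightarrow> dist (g (x + t)) (g x) < min d 1"
    using uniform_continuity[OF g(1), of "min d 1"] d by auto
  have "\<exists>H. continuous_on UNIV H \<and> (\<forall>x. g (x + t) = g x * cis (H x)) \<and> (\<forall>x. \<bar>H x\<bar> \<le> e)"
    if t: "t \<in> U" for t
  proof -
    define q where "q x = g (x + t) / g x" for x
    have gnz: "g x \<noteq> 0" for x using g(2)[of x] by auto
    have near: "dist (q x) 1 < min d 1" for x
    proof -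
      have "dist (q x) 1 = norm ((g (x + t) - g x) / g x)"
        using gnz[of x] by (simp add: q_def dist_norm diff_divide_distrib)
      also have "\<dots> = dist (g (x + t)) (g x)"
        by (simp add: norm_divide g(2) dist_norm)
      finally show ?thesis using U(3)[OF t] by simp
    qed
    have Re: "Re (q x) > 0" for x
      using near[of x] abs_Re_le_cmod[of "q x - 1"] by (auto simp: dist_norm)
    have qc: "continuous_on UNIV q"
      unfolding q_def using gnz by (intro continuous_intros continuous_compose[OF g(1)] g(1)) auto
    have "continuous_on UNIV (\<lambda>x. Im (Ln (q x)))"
      using Re by (intro continuous_intros qc) (auto simp: complex_nonpos_Reals_iff not_le)
    moreover have "g (x + t) = g x * cis (Im (Ln (q x)))" for x
    proof -
      have "norm (q x) = 1" by (simp add: q_def norm_divide g(2))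
      then have "q x \<noteq> 0" by auto
      have "Re (Ln (q x)) = 0" using \<open>q x \<noteq> 0\<close> \<open>norm (q x) = 1\<close> by (simp add: Re_Ln)
      then have "Ln (q x) = \<i> * of_real (Im (Ln (q x)))"
        by (simp add: complex_eq_iff)
      then have "cis (Im (Ln (q x))) = q x"
        using \<open>q x \<noteq> 0\<close> exp_Ln[of "q x"] by (simp add: cis_conv_exp)
      then show ?thesis using gnz by (simp add: q_def)
    qed
    ultimately show ?thesis
      using d(2) near by (intro exI[of _ "\<lambda>x. Im (Ln (q x))"]) (auto intro: less_imp_le)
  qed
  then show ?thesis using that U by blast
qed

text \<open>
  The set of \<open>t\<close> for which \<open>g (x + t) / g x\<close> has a continuous logarithm is a subgroup containing a
  neighbourhood of \<open>0\<close>, hence open and closed.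
\<close>

lemma quotient_logarithm:
  fixes g :: "'a \<Rightarrow> complex"
  assumes g: "continuous_on UNIV g" "\<And>x. norm (g x) = 1"
  shows "\<exists>H :: 'a \<Rightarrow> real. continuous_on UNIV H \<and> (\<forall>x. g (x + t) = g x * cis (H x))"
proof -
  define S where "S = {t. \<exists>H :: 'a \<Rightarrow> real. continuous_on UNIV H \<and> (\<forall>x. g (x + t) = g x * cis (H x))}"
  obtain U where U: "open U" "0 \<in> U" and logs:
    "\<And>t. t \<in> U \<Longrightarrow> \<exists>H. continuous_on UNIV H \<and> (\<forall>x. g (x + t) = g x * cis (H x)) \<and> (\<forall>x. \<bar>H x\<bar> \<le> 1)"
    using small_logarithms[OF g zero_less_one] by metis
  have US: "U \<subseteq> S"
    using logs unfolding S_def by fast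
  have add: "s + t \<in> S" if st: "s \<in> S" "t \<in> S" for s t
  proof -
    obtain H where H: "continuous_on UNIV H" "\<And>x. g (x + s) = g x * cis (H x :: real)"
      using st(1) unfolding S_def by blast
    obtain K where K: "continuous_on UNIV K" "\<And>x. g (x + t) = g x * cis (K x :: real)"
      using st(2) unfolding S_def by blast
    have "continuous_on UNIV (\<lambda>x. H x + K (x + s))"
      by (intro continuous_intros H continuous_compose[OF K(1)])
    moreover have "g (x + (s + t)) = g x * cis (H x + K (x + s))" for x
      using K(2)[of "x + s"] H(2)[of x] by (simp add: cis_mult[symmetric] mult.assoc add.assoc)
    ultimately show ?thesis unfolding S_def by blast
  qed
  have "open S"
    unfolding open_subopen[of S]
  proof
    fix s assume s: "s \<in> S"
    have "open ((\<lambda>y. y - s) -` U)" using U by (intro open_vimage continuous_intros)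
    moreover have "(\<lambda>y. y - s) -` U \<subseteq> S"
    proof
      fix y assume "y \<in> (\<lambda>y. y - s) -` U"
      then have "s + (y - s) \<in> S" using US by (intro add s) auto
      then show "y \<in> S" by simp
    qed
    ultimately show "\<exists>T. open T \<and> s \<in> T \<and> T \<subseteq> S"
      using U(2) by (intro exI[of _ "(\<lambda>y. y - s) -` U"]) auto
  qed
  moreover have "open (- S)"
    unfolding open_subopen[of "- S"]
  proof
    fix s assume s: "s \<in> - S"
    have "open ((\<lambda>y. s - y) -` U)" using U by (intro open_vimage continuous_intros)
    moreover have "(\<lambda>y. s - y) -` U \<subseteq> - S"
    proof
      fix y assume "y \<in> (\<lambda>y. s - y) -` U"
      then have "y + (s - y) \<in> S" if "y \<in> S" using that US by (intro add) auto
      then show "y \<in> - S" using s by auto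
    qed
    ultimately show "\<exists>T. open T \<and> s \<in> T \<and> T \<subseteq> - S"
      using U(2) by (intro exI[of _ "(\<lambda>y. s - y) -` U"]) auto
  qed
  moreover have "0 \<in> S" using U US by auto
  ultimately have "S = UNIV"
    using connectedD[OF connected_group, of S "- S"] by auto
  then show ?thesis unfolding S_def by blast
qed

text \<open>
  Write \<open>g (x + t) = g x c(t) exp (i K\<^sub>t x)\<close> where \<open>K\<^sub>t\<close> has integral zero.
  This normalization makes \<open>K\<^sub>t\<close> and \<open>c(t)\<close> unique, so \<open>c\<close> is multiplicative and \<open>K\<close> is an additive
  cocycle; \<open>c\<close> is the character, and evaluation at \<open>x = 0\<close> gives the real function \<open>t \<mapsto> K\<^sub>t 0\<close>.
\<close>

theorem circle_map_decomposition:
  fixes g :: "'a \<Rightarrow> complex"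
  assumes g: "continuous_on UNIV g" "\<And>x. norm (g x) = 1"
  obtains \<xi> h where "character \<xi>" "continuous_on UNIV h" "h 0 = (0::real)"
    "\<And>x. g x = g 0 * \<xi> x * cis (h x)"
proof -
  have gnz: "g x \<noteq> 0" for x using g(2)[of x] by auto
  define R where "R t K c \<longleftrightarrow> continuous_on UNIV K \<and> (\<integral>x. K x \<partial>\<mu>) = (0::real)
      \<and> (\<forall>x. g (x + t) = g x * (c * cis (K x)))" for t :: 'a and K c
  have normalize: "R t (\<lambda>x. H x - (\<integral>y. H y \<partial>\<mu>)) (cis (\<integral>y. H y \<partial>\<mu>))"
    if "continuous_on UNIV H" "\<And>x. g (x + t) = g x * cis (H x)" for t H
    unfolding R_def
  proof (intro conjI allI)
    show "continuous_on UNIV (\<lambda>x. H x - (\<integral>y. H y \<partial>\<mu>))" by (intro continuous_intros that)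
    show "(\<integral>x. H x - (\<integral>y. H y \<partial>\<mu>) \<partial>\<mu>) = 0"
      using integral_diff_continuous[OF that(1) continuous_on_const[of UNIV "\<integral>y. H y \<partial>\<mu>"]] prob_space by simp
    show "g (x + t) = g x * (cis (\<integral>y. H y \<partial>\<mu>) * cis (H x - (\<integral>y. H y \<partial>\<mu>)))" for x
      using that(2) by (simp add: cis_mult)
  qed
  have "\<exists>K c. R t K c" for t
    using quotient_logarithm[OF g, of t] normalize by blast
  then obtain K c where R: "\<And>t. R t (K t) (c t)" by metis
  have g_add: "g (x + t) = g x * (c t * cis (K t x))" for x t
    using R[of t] unfolding R_def by blast
  have unique: "K' x = K t x \<and> c' = c t" if "R t K' c'" for t K' c' and x :: 'a
  proof -
    have eq: "c' * cis (K' x) = c t * cis (K t x)" for x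
    proof -
      have "g x * (c' * cis (K' x)) = g x * (c t * cis (K t x))"
        using that g_add[of x t] unfolding R_def by simp
      then show ?thesis using gnz[of x] by simp
    qed
    have "c' \<noteq> 0"
    proof
      assume "c' = 0"
      then have "g (x + t) = 0" using that unfolding R_def by simp
      then show False using gnz by blast
    qed
    define D where "D = (\<lambda>x. K' x - K t x)"
    have D: "continuous_on UNIV D"
      unfolding D_def using that R[of t] by (intro continuous_intros) (auto simp: R_def)
    have "cis (D x) = c t / c'" for x
      using eq[of x] \<open>c' \<noteq> 0\<close> by (simp add: D_def cis_divide[symmetric] field_simps)
    then have "D y = D x" for y by (rule constant_if_cis_constant[OF D])
    then have "(\<integral>y. D y \<partial>\<mu>) = (\<integral>y. D x \<partial>\<mu>)"
      by (intro Bochner_Integration.integral_cong refl)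
    then have "(\<integral>y. D y \<partial>\<mu>) = D x" using prob_space by simp
    moreover have "(\<integral>y. D y \<partial>\<mu>) = 0"
      unfolding D_def using that R[of t] by (subst integral_diff_continuous) (auto simp: R_def)
    ultimately have "K' x = K t x" by (simp add: D_def)
    then show ?thesis using eq[of x] by simp
  qed
  have cocycle: "K (s + t) x = K s x + K t (x + s)" and c_mult: "c (s + t) = c s * c t" for s t x :: 'a
  proof -
    have Kc: "continuous_on UNIV (K s)" "continuous_on UNIV (K t)" using R by (auto simp: R_def)
    have c2: "continuous_on UNIV (\<lambda>x. K t (x + s))"
      by (intro continuous_compose[OF Kc(2)] continuous_intros)
    have "R (s + t) (\<lambda>x. K s x + K t (x + s)) (c s * c t)"
      unfolding R_def
    proof (intro conjI allI)
      show "continuous_on UNIV (\<lambda>x. K s x + K t (x + s))" by (intro continuous_intros Kc c2)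
      show "(\<integral>x. K s x + K t (x + s) \<partial>\<mu>) = 0"
        using integral_add_continuous[OF Kc(1) c2] integral_translate[OF Kc(2), of s] R by (simp add: R_def)
      fix x
      have "g (x + (s + t)) = g (x + s) * (c t * cis (K t (x + s)))"
        using g_add[of "x + s" t] by (simp add: add.assoc)
      also have "g (x + s) = g x * (c s * cis (K s x))"
        by (rule g_add)
      finally show "g (x + (s + t)) = g x * (c s * c t * cis (K s x + K t (x + s)))"
        by (simp add: cis_mult[symmetric] mult_ac)
    qed
    from unique[OF this, of x] show "K (s + t) x = K s x + K t (x + s)" "c (s + t) = c s * c t" by auto
  qed
  have small: "\<exists>U. open U \<and> 0 \<in> U \<and> (\<forall>t\<in>U. (\<forall>x. \<bar>K t x\<bar> \<le> 2 * e) \<and> (\<exists>a. \<bar>a\<bar> \<le> e \<and> c t = cis a))"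
    if e: "e > 0" for e
  proof -
    obtain U where U: "open U" "0 \<in> U"
      "\<And>t. t \<in> U \<Longrightarrow> \<exists>H. continuous_on UNIV H \<and> (\<forall>x. g (x + t) = g x * cis (H x)) \<and> (\<forall>x. \<bar>H x\<bar> \<le> e)"
      using small_logarithms[OF g e] by blast
    have "(\<forall>x. \<bar>K t x\<bar> \<le> 2 * e) \<and> (\<exists>a. \<bar>a\<bar> \<le> e \<and> c t = cis a)" if t: "t \<in> U" for t
    proof -
      obtain H where H: "continuous_on UNIV H" "\<And>x. g (x + t) = g x * cis (H x)" "\<And>x. \<bar>H x\<bar> \<le> e"
        using U(3)[OF t] by blast
      define a where "a = (\<integral>y. H y \<partial>\<mu>)"
      have "\<bar>a\<bar> \<le> (\<integral>y. \<bar>H y\<bar> \<partial>\<mu>)"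
        unfolding a_def by (rule integral_abs_bound)
      also have "\<dots> \<le> (\<integral>y. e \<partial>\<mu>)"
        using H by (intro integral_mono continuous_integrable continuous_intros)
      finally have a: "\<bar>a\<bar> \<le> e" using prob_space by simp
      have eq: "H x - a = K t x \<and> cis a = c t" for x
        using unique[OF normalize[OF H(1,2)]] by (simp add: a_def)
      have "\<bar>K t x\<bar> \<le> 2 * e" for x
        using eq[of x] H(3)[of x] a by linarith
      then show ?thesis using eq a by metis
    qed
    then show ?thesis using U by blast
  qed
  have c_norm: "norm (c t) = 1" for t
  proof -
    have "norm (g (0 + t)) = norm (g 0 * (c t * cis (K t 0)))"
      by (simp only: g_add)
    then show ?thesis by (simp add: norm_mult g(2))
  qed
  have "continuous_on UNIV c"
  proof (rule continuous_if_locally_close)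
    fix x :: 'a and e :: real assume "e > 0"
    have "isCont (\<lambda>a::real. cis a) 0"
      unfolding cis_conv_exp by (intro continuous_intros)
    with \<open>e > 0\<close> obtain d where d: "d > 0" "\<And>a::real. \<bar>a\<bar> < d \<Longrightarrow> dist (cis a) 1 < e"
      unfolding continuous_at_eps_delta by (auto simp: dist_real_def)
    obtain U where U: "open U" "0 \<in> U" "\<And>t. t \<in> U \<Longrightarrow> \<exists>a. \<bar>a\<bar> \<le> d / 2 \<and> c t = cis a"
      using small[of "d / 2"] d(1) by auto
    have "dist (c (x + t)) (c x) < e" if t: "t \<in> U" for t
    proof -
      obtain a where a: "\<bar>a\<bar> \<le> d / 2" "c t = cis a" using U(3)[OF t] by blast
      have "c (x + t) - c x = c x * (c t - 1)" by (simp add: c_mult algebra_simps)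
      then have "dist (c (x + t)) (c x) = dist (c t) 1"
        by (simp add: dist_norm norm_mult c_norm)
      also have "\<dots> < e" using a d by simp
      finally show ?thesis .
    qed
    then show "\<exists>U. open U \<and> 0 \<in> U \<and> (\<forall>t\<in>U. dist (c (x + t)) (c x) < e)" using U by blast
  qed
  then have "character c" by (simp add: character_def c_mult c_norm)
  moreover have "continuous_on UNIV (\<lambda>t. K t 0)"
  proof (rule continuous_if_locally_close)
    fix x :: 'a and e :: real assume "e > 0"
    then obtain U where U: "open U" "0 \<in> U" "\<And>t y. t \<in> U \<Longrightarrow> \<bar>K t y\<bar> \<le> 2 * (e / 4)"
      using small[of "e / 4"] by auto
    have "dist (K (x + t) 0) (K x 0) < e" if "t \<in> U" for t
      using U(3)[OF that, of x] \<open>e > 0\<close> by (simp add: cocycle dist_real_def)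
    then show "\<exists>U. open U \<and> 0 \<in> U \<and> (\<forall>t\<in>U. dist (K (x + t) 0) (K x 0) < e)" using U by blast
  qed
  moreover have "K 0 0 = 0" using cocycle[of 0 0 0] by simp
  moreover have "g x = g 0 * c x * cis (K x 0)" for x
    using g_add[of 0 x] by (simp add: mult.assoc)
  ultimately show ?thesis using that by blast
qed

end


section \<open>Laurent polynomials acting on square-summable functions\<close>

text \<open>
  With distinct powers of an integer \<open>N\<close> as weights, \<open>l v\<close> is the value at \<open>N\<close> of a polynomial
  whose coefficients are the entries of \<open>v\<close>; it suffices to avoid finitely many roots.
\<close>

lemma separating_functional:
  fixes F :: "(int ^ 'd::finite) set"
  assumes "finite F" "0 \<notin> F"
  obtains l :: "int ^ 'd \<Rightarrow> int" where "\<And>x y. l (x + y) = l x + l y" "\<And>v. v \<in> F \<Longrightarrow> l v \<noteq> 0"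
proof -
  obtain e :: "'d \<Rightarrow> nat" where e: "inj e"
    using finite_imp_inj_to_nat_seg[of "UNIV :: 'd set"] by auto
  define P where "P v = (\<Sum>i\<in>UNIV. monom (v $ i) (e i))" for v :: "int ^ 'd"
  have "P v \<noteq> 0" if "v \<noteq> 0" for v
  proof -
    obtain j where j: "v $ j \<noteq> 0" using \<open>v \<noteq> 0\<close> by (auto simp: vec_eq_iff)
    have "coeff (P v) (e j) = (\<Sum>i\<in>UNIV. if i = j then v $ i else 0)"
      unfolding P_def coeff_sum by (intro sum.cong) (auto simp: coeff_monom dest: injD[OF e])
    also have "\<dots> = v $ j" by simp
    finally show ?thesis using j by auto
  qed
  then have "P v \<noteq> 0" if "v \<in> F" for v using that assms(2) by metis
  then have "finite (\<Union>v\<in>F. {x. poly (P v) x = 0})"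
    using assms(1) by (intro finite_UN_I poly_roots_finite) auto
  then obtain N where N: "N \<notin> (\<Union>v\<in>F. {x. poly (P v) x = 0})"
    using ex_new_if_finite[OF infinite_UNIV_int] by blast
  show ?thesis
  proof
    show "poly (P (x + y)) N = poly (P x) N + poly (P y) N" for x y
      by (simp add: P_def poly_sum poly_monom sum.distrib distrib_right)
    show "poly (P v) N \<noteq> 0" if "v \<in> F" for v using N that by auto
  qed
qed

text \<open>
  The Laurent polynomial ring has no zero divisors: compare the terms that are maximal for an
  additive functional separating the finitely many exponents involved.
\<close>

lemma convolution_injective:
  fixes p a :: "int ^ 'd::finite \<Rightarrow> real"
  assumes S: "finite S" "\<And>v. v \<notin> S \<Longrightarrow> p v = 0" "p s \<noteq> 0" and I: "finite I"
    and conv: "\<And>v. (\<Sum>b\<in>I. a b * p (v - b)) = 0"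
  shows "\<forall>b\<in>I. a b = 0"
proof (rule ccontr)
  assume not: "\<not> (\<forall>b\<in>I. a b = 0)"
  define A where "A = {b \<in> I. a b \<noteq> 0}"
  define B where "B = {v. p v \<noteq> 0}"
  have A: "finite A" "A \<noteq> {}" using I not by (auto simp: A_def)
  have "B \<subseteq> S" using S(2) by (auto simp: B_def)
  then have B: "finite B" "B \<noteq> {}" using S finite_subset by (auto simp: B_def)
  define F where "F = (\<lambda>(x, y). x - y) ` (A \<times> A) - {0}"
  have "finite F" "0 \<notin> F" using A by (auto simp: F_def)
  then obtain l :: "int ^ 'd \<Rightarrow> int" where l: "\<And>x y. l (x + y) = l x + l y" "\<And>v. v \<in> F \<Longrightarrow> l v \<noteq> 0"
    by (rule separating_functional) blast
  have l_inj: "x = y" if "x \<in> A" "y \<in> A" "l x = l y" for x y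
  proof (rule ccontr)
    assume "x \<noteq> y"
    then have "x - y \<in> F" using that by (force simp: F_def)
    then show False using l(1)[of "x - y" y] l(2) that by simp
  qed
  obtain b0 where b0: "b0 \<in> A" "\<And>b. b \<in> A \<Longrightarrow> l b \<le> l b0"
  proof -
    have "Max (l ` A) \<in> l ` A" using A by simp
    then obtain m where "m \<in> A" "l m = Max (l ` A)" by auto
    then show ?thesis using that[of m] A by simp
  qed
  obtain s0 where s0: "s0 \<in> B" "\<And>b. b \<in> B \<Longrightarrow> l b \<le> l s0"
  proof -
    have "Max (l ` B) \<in> l ` B" using B by simp
    then obtain m where "m \<in> B" "l m = Max (l ` B)" by auto
    then show ?thesis using that[of m] B by simp
  qed
  have "a b * p (b0 + s0 - b) = 0" if b: "b \<in> I" "b \<noteq> b0" for b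
  proof (rule ccontr)
    assume "a b * p (b0 + s0 - b) \<noteq> 0"
    then have "b \<in> A" "b0 + s0 - b \<in> B" using b by (auto simp: A_def B_def)
    then have "l b \<le> l b0" "l (b0 + s0 - b) \<le> l s0" using b0 s0 by auto
    moreover have "l (b0 + s0 - b) + l b = l b0 + l s0"
      using l(1)[of "b0 + s0 - b" b] l(1)[of b0 s0] by simp
    ultimately have "l b = l b0" by linarith
    then show False using l_inj \<open>b \<in> A\<close> b0(1) b(2) by blast
  qed
  then have "(\<Sum>b\<in>I. a b * p (b0 + s0 - b)) = (\<Sum>b\<in>I. if b = b0 then a b0 * p s0 else 0)"
    by (intro sum.cong) auto
  also have "\<dots> = a b0 * p s0" using b0(1) I by (simp add: A_def)
  finally show False using conv b0(1) s0(1) by (auto simp: A_def B_def)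
qed

text \<open>
  Gram-Schmidt orthonormalization, for functions on a finite set whose size is not fixed by a type.
\<close>

lemma orthonormal_combinations:
  fixes w :: "'i \<Rightarrow> 'n \<Rightarrow> real"
  assumes "finite I" and "finite N"
    and "\<And>a. (\<forall>v\<in>N. (\<Sum>i\<in>I. a i * w i v) = 0) \<Longrightarrow> \<forall>i\<in>I. a i = 0"
  shows "\<exists>b :: 'i \<Rightarrow> 'n \<Rightarrow> real. (\<forall>j\<in>I. \<exists>c. \<forall>v. b j v = (\<Sum>i\<in>I. c i * w i v)) \<and>
    (\<forall>j\<in>I. \<forall>k\<in>I. (\<Sum>v\<in>N. b j v * b k v) = (if j = k then 1 else 0))"
  using assms(1,3)
proof (induction I)
  case empty
  then show ?case by simp
next
  case (insert x I)
  have "\<forall>i\<in>I. a i = 0" if a: "\<forall>v\<in>N. (\<Sum>i\<in>I. a i * w i v) = 0" for a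
  proof -
    have "(\<Sum>i\<in>insert x I. (if i = x then 0 else a i) * w i v) = (\<Sum>i\<in>I. a i * w i v)" for v
      using insert.hyps by (simp, intro sum.cong) auto
    then have "\<forall>i\<in>insert x I. (if i = x then 0 else a i) = 0"
      using a by (intro insert.prems) auto
    then show ?thesis using insert.hyps by (metis insertCI)
  qed
  from insert.IH[OF this] obtain b where
    span: "\<forall>j\<in>I. \<exists>c. \<forall>v. b j v = (\<Sum>i\<in>I. c i * w i v)" and
    orth: "\<forall>j\<in>I. \<forall>k\<in>I. (\<Sum>v\<in>N. b j v * b k v) = (if j = k then 1 else 0)"
    by blast
  from span obtain c where c: "\<And>j v. j \<in> I \<Longrightarrow> b j v = (\<Sum>i\<in>I. c j i * w i v)"
    by metis
  define s where "s j = (\<Sum>v\<in>N. w x v * b j v)" for j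
  define w' where "w' v = w x v - (\<Sum>j\<in>I. s j * b j v)" for v
  define d where "d i = (if i = x then 1 else - (\<Sum>j\<in>I. s j * c j i))" for i
  have w'_span: "w' v = (\<Sum>i\<in>insert x I. d i * w i v)" for v
  proof -
    have "(\<Sum>j\<in>I. s j * b j v) = (\<Sum>j\<in>I. \<Sum>i\<in>I. s j * c j i * w i v)"
      using c by (intro sum.cong) (auto simp: sum_distrib_left mult.assoc)
    also have "\<dots> = (\<Sum>i\<in>I. (\<Sum>j\<in>I. s j * c j i) * w i v)"
      by (subst sum.swap) (simp add: sum_distrib_right)
    also have "\<dots> = - (\<Sum>i\<in>I. d i * w i v)"
      using insert.hyps by (subst sum_negf[symmetric], intro sum.cong) (auto simp: d_def)
    finally show ?thesis using insert.hyps by (simp add: w'_def d_def)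
  qed
  define n where "n = (\<Sum>v\<in>N. (w' v)\<^sup>2)"
  have "n \<noteq> 0"
  proof
    assume "n = 0"
    then have "\<forall>v\<in>N. w' v = 0"
      unfolding n_def using sum_nonneg_eq_0_iff[OF \<open>finite N\<close>, of "\<lambda>v. (w' v)\<^sup>2"] by simp
    then have "\<forall>i\<in>insert x I. d i = 0" using w'_span by (intro insert.prems) auto
    then show False by (simp add: d_def)
  qed
  moreover have "n \<ge> 0" unfolding n_def by (intro sum_nonneg) auto
  ultimately have n: "n > 0" by simp
  define bx where "bx v = w' v / sqrt n" for v
  have "(\<Sum>v\<in>N. w' v * b k v) = 0" if k: "k \<in> I" for k
  proof -
    have "(\<Sum>v\<in>N. w' v * b k v) = s k - (\<Sum>v\<in>N. \<Sum>j\<in>I. s j * (b j v * b k v))"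
      by (simp add: w'_def s_def left_diff_distrib sum_subtractf sum_distrib_right mult.assoc)
    also have "(\<Sum>v\<in>N. \<Sum>j\<in>I. s j * (b j v * b k v)) = (\<Sum>j\<in>I. s j * (\<Sum>v\<in>N. b j v * b k v))"
      by (subst sum.swap) (simp add: sum_distrib_left)
    also have "\<dots> = (\<Sum>j\<in>I. if j = k then s k else 0)"
      using orth k by (intro sum.cong) auto
    also have "\<dots> = s k" using k insert.hyps by simp
    finally show ?thesis by simp
  qed
  then have bx_orth: "(\<Sum>v\<in>N. bx v * b k v) = 0" if "k \<in> I" for k
    using that by (simp add: bx_def sum_divide_distrib[symmetric])
  have bx_norm: "(\<Sum>v\<in>N. bx v * bx v) = 1"
  proof -
    have "(\<Sum>v\<in>N. bx v * bx v) = (\<Sum>v\<in>N. (w' v)\<^sup>2 / n)"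
      using n by (intro sum.cong) (auto simp: bx_def power2_eq_square)
    also have "\<dots> = 1" using n by (simp add: sum_divide_distrib[symmetric] n_def[symmetric])
    finally show ?thesis .
  qed
  define b' where "b' j = (if j = x then bx else b j)" for j
  show ?case
  proof (intro exI[of _ b'] conjI ballI)
    fix j assume j: "j \<in> insert x I"
    show "\<exists>c. \<forall>v. b' j v = (\<Sum>i\<in>insert x I. c i * w i v)"
    proof (cases "j = x")
      case True
      have "bx v = (\<Sum>i\<in>insert x I. (d i / sqrt n) * w i v)" for v
        unfolding bx_def w'_span by (simp only: sum_divide_distrib times_divide_eq_left)
      then show ?thesis using True by (intro exI[of _ "\<lambda>i. d i / sqrt n"]) (simp add: b'_def)
    next
      case False
      then have "b' j v = (\<Sum>i\<in>insert x I. (if i = x then 0 else c j i) * w i v)" for v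
        using c[of j v] j insert.hyps by (simp add: b'_def, intro sum.cong) auto
      then show ?thesis by (intro exI[of _ "\<lambda>i. if i = x then 0 else c j i"] allI)
    qed
  next
    fix j k assume jk: "j \<in> insert x I" "k \<in> insert x I"
    have bx_orth': "(\<Sum>v\<in>N. b k v * bx v) = 0" if "k \<in> I" for k
      using bx_orth[OF that] by (simp only: mult.commute)
    have "b' i = b i" if "i \<in> I" for i
      using that insert.hyps by (auto simp: b'_def)
    then show "(\<Sum>v\<in>N. b' j v * b' k v) = (if j = k then 1 else 0)"
      using jk orth bx_orth bx_orth' bx_norm insert.hyps
      by (cases "j = x"; cases "k = x") (simp_all add: b'_def)
  qed
qed

text \<open>
  The squared distances from the standard basis vectors to a subspace add up to its codimension
  (the trace of the complementary projection), so some basis vector has at most the average.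
\<close>

lemma basis_vector_near_span:
  fixes w :: "'i \<Rightarrow> 'n \<Rightarrow> real"
  assumes I: "finite I" and N: "finite N" "N \<noteq> {}"
    and indep: "\<And>a. (\<forall>v\<in>N. (\<Sum>i\<in>I. a i * w i v) = 0) \<Longrightarrow> \<forall>i\<in>I. a i = 0"
  shows "\<exists>u\<in>N. \<exists>a. (\<Sum>v\<in>N. ((if v = u then 1 else 0) - (\<Sum>i\<in>I. a i * w i v))\<^sup>2)
      \<le> 1 - real (card I) / real (card N)"
proof -
  obtain b where
    span: "\<forall>j\<in>I. \<exists>c. \<forall>v. b j v = (\<Sum>i\<in>I. c i * w i v)" and
    orth: "\<forall>j\<in>I. \<forall>k\<in>I. (\<Sum>v\<in>N. b j v * b k v) = (if j = k then 1 else 0 :: real)"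
    using orthonormal_combinations[OF I N(1) indep] by blast
  from span obtain c where c: "\<And>j v. j \<in> I \<Longrightarrow> b j v = (\<Sum>i\<in>I. c j i * w i v)"
    by metis
  have "\<exists>u\<in>N. (\<Sum>j\<in>I. (b j u)\<^sup>2) \<ge> real (card I) / real (card N)"
  proof (rule ccontr)
    assume "\<not> ?thesis"
    then have "(\<Sum>u\<in>N. \<Sum>j\<in>I. (b j u)\<^sup>2) < (\<Sum>u\<in>N. real (card I) / real (card N))"
      using N by (intro sum_strict_mono) (auto simp: not_le)
    also have "\<dots> = real (card I)" using N by simp
    also have "(\<Sum>u\<in>N. \<Sum>j\<in>I. (b j u)\<^sup>2) = (\<Sum>j\<in>I. \<Sum>u\<in>N. b j u * b j u)"
      by (subst sum.swap) (simp add: power2_eq_square)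
    also have "\<dots> = (\<Sum>j\<in>I. 1)" using orth by (intro sum.cong) auto
    finally show False by simp
  qed
  then obtain u where u: "u \<in> N" "(\<Sum>j\<in>I. (b j u)\<^sup>2) \<ge> real (card I) / real (card N)" by blast
  define e where "e v = (if v = u then 1 else 0 :: real)" for v
  define q where "q v = (\<Sum>j\<in>I. b j u * b j v)" for v
  define Q where "Q = (\<Sum>j\<in>I. (b j u)\<^sup>2)"
  have eq: "(\<Sum>v\<in>N. e v * q v) = Q"
  proof -
    have "(\<Sum>v\<in>N. e v * q v) = (\<Sum>v\<in>N. if v = u then q u else 0)"
      by (intro sum.cong) (auto simp: e_def)
    also have "\<dots> = Q" using u N by (simp add: q_def Q_def power2_eq_square)
    finally show ?thesis .
  qed
  have ee: "(\<Sum>v\<in>N. (e v)\<^sup>2) = 1"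
  proof -
    have "(\<Sum>v\<in>N. (e v)\<^sup>2) = (\<Sum>v\<in>N. if v = u then 1 else 0)"
      by (intro sum.cong) (auto simp: e_def)
    then show ?thesis using u N by simp
  qed
  have qq: "(\<Sum>v\<in>N. (q v)\<^sup>2) = Q"
  proof -
    have "(\<Sum>v\<in>N. (q v)\<^sup>2) = (\<Sum>v\<in>N. \<Sum>j\<in>I. \<Sum>k\<in>I. b j u * b k u * (b j v * b k v))"
      by (simp add: q_def power2_eq_square sum_product mult_ac)
    also have "\<dots> = (\<Sum>j\<in>I. \<Sum>v\<in>N. \<Sum>k\<in>I. b j u * b k u * (b j v * b k v))"
      by (rule sum.swap)
    also have "\<dots> = (\<Sum>j\<in>I. \<Sum>k\<in>I. b j u * b k u * (\<Sum>v\<in>N. b j v * b k v))"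
      by (intro sum.cong refl, subst sum.swap) (simp add: sum_distrib_left)
    also have "\<dots> = (\<Sum>j\<in>I. \<Sum>k\<in>I. if k = j then (b j u)\<^sup>2 else 0)"
      using orth by (intro sum.cong) (auto simp: power2_eq_square)
    also have "\<dots> = Q" using I by (simp add: Q_def)
    finally show ?thesis .
  qed
  have "(\<Sum>v\<in>N. (e v - q v)\<^sup>2) = (\<Sum>v\<in>N. (e v)\<^sup>2) + (\<Sum>v\<in>N. (q v)\<^sup>2) - 2 * (\<Sum>v\<in>N. e v * q v)"
    by (simp add: power2_diff sum.distrib sum_subtractf sum_distrib_left mult.assoc)
  also have "\<dots> = 1 - Q" by (simp add: eq ee qq)
  also have "\<dots> \<le> 1 - real (card I) / real (card N)" using u by (simp add: Q_def)
  finally have le: "(\<Sum>v\<in>N. (e v - q v)\<^sup>2) \<le> 1 - real (card I) / real (card N)" .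
  define a where "a i = (\<Sum>j\<in>I. b j u * c j i)" for i
  have "q v = (\<Sum>i\<in>I. a i * w i v)" for v
  proof -
    have "q v = (\<Sum>j\<in>I. \<Sum>i\<in>I. b j u * c j i * w i v)"
      using c by (simp add: q_def sum_distrib_left mult.assoc)
    also have "\<dots> = (\<Sum>i\<in>I. a i * w i v)"
      by (subst sum.swap) (simp add: a_def sum_distrib_right)
    finally show ?thesis .
  qed
  then show ?thesis using le u(1) unfolding e_def by auto
qed

lemma box_eq_image:
  "{v :: int ^ 'd::finite. \<forall>i. lo \<le> v $ i \<and> v $ i < hi} = vec_lambda ` (UNIV \<rightarrow>\<^sub>E {lo..<hi})"
proof (intro equalityI subsetI)
  fix v :: "int ^ 'd" assume "v \<in> {v. \<forall>i. lo \<le> v $ i \<and> v $ i < hi}"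
  then show "v \<in> vec_lambda ` (UNIV \<rightarrow>\<^sub>E {lo..<hi})"
    by (intro image_eqI[of _ _ "vec_nth v"]) (auto simp: PiE_def)
qed (auto simp: PiE_def Pi_def)

lemma box_finite: "finite {v :: int ^ 'd::finite. \<forall>i. lo \<le> v $ i \<and> v $ i < hi}"
  unfolding box_eq_image by (intro finite_imageI finite_PiE) auto

lemma box_card: "card {v :: int ^ 'd::finite. \<forall>i. lo \<le> v $ i \<and> v $ i < hi} = nat (hi - lo) ^ CARD('d)"
proof -
  have "inj_on vec_lambda (UNIV \<rightarrow>\<^sub>E {lo..<hi})"
    by (intro inj_onI) (metis UNIV_I vec_lambda_inject)
  then have "card {v :: int ^ 'd. \<forall>i. lo \<le> v $ i \<and> v $ i < hi} = card ((UNIV :: 'd set) \<rightarrow>\<^sub>E {lo..<hi})"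
    unfolding box_eq_image by (rule card_image)
  also have "\<dots> = nat (hi - lo) ^ CARD('d)"
    by (subst card_PiE) simp_all
  finally show ?thesis .
qed

text \<open>
  The products of the Laurent polynomial \<open>p\<close> with the monomials from a large cube are linearly
  independent, so they span a subspace of the functions on a slightly larger cube whose codimension
  is small compared with the volume. Hence some unit vector is close to a multiple of \<open>p\<close>;
  shifting by \<open>u\<close>, so is the unit of the ring, in the norm of \<open>\<ell>\<^sup>2(\<int>\<^sup>d)\<close>.
\<close>

lemma unit_near_multiples:
  fixes p :: "int ^ 'd::finite \<Rightarrow> real"
  assumes S: "finite S" "\<And>v. v \<notin> S \<Longrightarrow> p v = 0" "p s \<noteq> 0" and e: "e > 0"
  obtains N I u a where "finite N" "finite I" "u \<in> N" "\<And>b g. b \<in> I \<Longrightarrow> g \<in> S \<Longrightarrow> b + g \<in> N"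
    "(\<Sum>v\<in>N. ((if v = u then 1 else 0) - (\<Sum>b\<in>I. a b * p (v - b)))\<^sup>2) \<le> e"
proof -
  \<comment> \<open>Any bound for the coordinates of the exponents in \<open>S\<close> will do.\<close>
  define R where "R = (\<Sum>g\<in>S. \<Sum>i\<in>UNIV. \<bar>g $ i\<bar>)"
  have R: "\<bar>g $ i\<bar> \<le> R" if "g \<in> S" for g i
  proof -
    have "\<bar>g $ i\<bar> \<le> (\<Sum>i\<in>UNIV. \<bar>g $ i\<bar>)" by (rule member_le_sum) auto
    also have "\<dots> \<le> R" unfolding R_def using that S(1)
      by (intro member_le_sum[of g S "\<lambda>g. \<Sum>i\<in>UNIV. \<bar>g $ i\<bar>"]) (auto intro: sum_nonneg)
    finally show ?thesis .
  qed
  have R0: "R \<ge> 0" unfolding R_def by (intro sum_nonneg) auto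
  have "(\<lambda>n. (real n / (real n + 2 * real_of_int R)) ^ CARD('d)) \<longlonglongrightarrow> 1 ^ CARD('d)"
    by (intro tendsto_power) real_asymp
  then have "\<forall>\<^sub>F n in sequentially. (real n / (real n + 2 * real_of_int R)) ^ CARD('d) > 1 - e"
    using e by (intro order_tendstoD(1)[where y = "1 ^ CARD('d)"]) auto
  then obtain n where n: "n > 0" "(real n / (real n + 2 * real_of_int R)) ^ CARD('d) > 1 - e"
    using eventually_happens[OF eventually_conj[OF eventually_gt_at_top[of 0]]] by auto
  define I where "I = {v :: int ^ 'd. \<forall>i. 0 \<le> v $ i \<and> v $ i < int n}"
  define N where "N = {v :: int ^ 'd. \<forall>i. - R \<le> v $ i \<and> v $ i < int n + R}"
  have fin: "finite I" "finite N" unfolding I_def N_def by (rule box_finite)+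
  have cards: "card I = n ^ CARD('d)" "card N = nat (int n + R + R) ^ CARD('d)"
    unfolding I_def N_def box_card by simp_all
  have ratio: "real (card I) / real (card N) = (real n / (real n + 2 * real_of_int R)) ^ CARD('d)"
    using R0 by (simp add: cards power_divide add_ac)
  have "card N > 0" using n R0 unfolding cards by simp
  then have "N \<noteq> {}" by auto
  have I_N: "b + g \<in> N" if "b \<in> I" "g \<in> S" for b g
    unfolding N_def
  proof (intro CollectI allI)
    fix i
    have "0 \<le> b $ i" "b $ i < int n" using that by (auto simp: I_def)
    then show "- R \<le> (b + g) $ i \<and> (b + g) $ i < int n + R"
      using R[OF that(2), of i] by auto
  qed
  have "\<forall>i\<in>I. a i = 0" if a: "\<forall>v\<in>N. (\<Sum>b\<in>I. a b * p (v - b)) = 0" for a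
  proof (rule convolution_injective[where p = p and S = S, OF S(1) S(2) S(3) fin(1)])
    fix v
    show "(\<Sum>b\<in>I. a b * p (v - b)) = 0"
    proof (cases "v \<in> N")
      case False
      have "p (v - b) = 0" if "b \<in> I" for b
      proof (rule S(2), rule)
        assume "v - b \<in> S"
        then show False using I_N[OF that, of "v - b"] False by simp
      qed
      then show ?thesis by simp
    qed (use a in auto)
  qed
  from basis_vector_near_span[where w = "\<lambda>b v. p (v - b)", OF fin \<open>N \<noteq> {}\<close> this]
  obtain u a where u: "u \<in> N"
    "(\<Sum>v\<in>N. ((if v = u then 1 else 0) - (\<Sum>b\<in>I. a b * p (v - b)))\<^sup>2) \<le> 1 - real (card I) / real (card N)"
    by blast
  then have "(\<Sum>v\<in>N. ((if v = u then 1 else 0) - (\<Sum>b\<in>I. a b * p (v - b)))\<^sup>2) \<le> e"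
    using n(2) ratio by simp
  then show ?thesis using that fin u(1) I_N by blast
qed


section \<open>Mixing actions\<close>

context compact_abelian_haar
begin

lemma l2norm_character_sum:
  assumes N: "finite N" and \<xi>: "\<And>v. v \<in> N \<Longrightarrow> character (\<xi> v)" and inj: "inj_on \<xi> N"
  shows "(l2norm (\<lambda>x. \<Sum>v\<in>N. r v * \<xi> v x))\<^sup>2 = (\<Sum>v\<in>N. (norm (r v))\<^sup>2)"
proof -
  have c: "continuous_on UNIV (\<xi> v)" if "v \<in> N" for v
    using \<xi>[OF that] by (rule character_continuous)
  have int: "integrable \<mu> (\<lambda>x. r v * cnj (r u) * (\<xi> v x * cnj (\<xi> u x)))" if "v \<in> N" "u \<in> N" for u v
    using that by (intro continuous_integrable continuous_intros c)
  have "complex_of_real ((l2norm (\<lambda>x. \<Sum>v\<in>N. r v * \<xi> v x))\<^sup>2)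
      = (\<integral>x. (\<Sum>v\<in>N. \<Sum>u\<in>N. r v * cnj (r u) * (\<xi> v x * cnj (\<xi> u x))) \<partial>\<mu>)"
    unfolding l2norm_squared_complex by (simp add: sum_product mult_ac)
  also have "\<dots> = (\<Sum>v\<in>N. \<Sum>u\<in>N. r v * cnj (r u) * (\<integral>x. \<xi> v x * cnj (\<xi> u x) \<partial>\<mu>))"
    using int by (simp add: Bochner_Integration.integral_sum Bochner_Integration.integrable_sum)
  also have "\<dots> = (\<Sum>v\<in>N. \<Sum>u\<in>N. if u = v then r v * cnj (r v) else 0)"
    using \<xi> inj by (intro sum.cong refl) (auto simp: integral_character_cnj dest: inj_onD)
  also have "\<dots> = (\<Sum>v\<in>N. of_real ((norm (r v))\<^sup>2))"
    using N by (simp add: complex_norm_square del: of_real_power)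
  finally show ?thesis
    by (simp only: of_real_sum[symmetric] of_real_eq_iff)
qed

end

locale mixing_action = compact_abelian_haar \<mu>
  for \<mu> :: "'a::topological_ab_group_add measure" +
  fixes \<alpha> :: "int ^ 'd::finite \<Rightarrow> 'a \<Rightarrow> 'a"
  assumes action: "algebraic_action \<alpha>" and mix: "mixing \<mu> \<alpha>"
begin

lemma act_0: "\<alpha> 0 x = x"
  and act_add: "\<alpha> (g + h) x = \<alpha> g (\<alpha> h x)"
  and act_hom: "\<alpha> g (x + y) = \<alpha> g x + \<alpha> g y"
  and act_continuous: "continuous_on UNIV (\<alpha> g)"
  using action by (auto simp: algebraic_action_def)

lemma act_inverse: "\<alpha> g (\<alpha> (- g) x) = x" "\<alpha> (- g) (\<alpha> g x) = x"
  using act_add[of g "- g" x] act_add[of "- g" g x] by (simp_all add: act_0)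

lemma act_zero: "\<alpha> g 0 = 0"
  using act_hom[of g 0 0] by simp

lemma continuous_act:
  fixes f :: "'a \<Rightarrow> 'b::topological_space"
  assumes "continuous_on UNIV f"
  shows "continuous_on UNIV (\<lambda>x. f (\<alpha> g x))"
  using continuous_compose[OF assms act_continuous] .

lemma character_act: "character \<xi> \<Longrightarrow> character (\<lambda>x. \<xi> (\<alpha> g x))"
  by (auto simp: character_def act_hom intro: continuous_act)

text \<open>
  The image of the Haar measure under an automorphism is translation invariant, and the average
  over \<open>x\<close> and \<open>y\<close> of \<open>f (x + y)\<close> shows that it then integrates \<open>f\<close> in the same way.
\<close>

lemma integral_act:
  fixes f :: "'a \<Rightarrow> complex"
  assumes f: "continuous_on UNIV f"
  shows "(\<integral>x. f (\<alpha> g x) \<partial>\<mu>) = (\<integral>x. f x \<partial>\<mu>)"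
proof -
  have meas: "\<alpha> g \<in> measurable \<mu> borel"
    by (rule continuous_measurable[OF act_continuous])
  define N where "N = distr \<mu> borel (\<alpha> g)"
  have N: "prob_space N" "sets N = sets borel"
    unfolding N_def using prob_space_distr[OF meas] by auto
  have int_N: "(\<integral>y. k y \<partial>N) = (\<integral>y. k (\<alpha> g y) \<partial>\<mu>)" if "continuous_on UNIV k" for k :: "'a \<Rightarrow> complex"
    unfolding N_def using borel_measurable_continuous_onI[OF that] by (rule integral_distr[OF meas])
  have inner: "(\<integral>y. f (x + y) \<partial>N) = (\<integral>y. f (\<alpha> g y) \<partial>\<mu>)" for x
  proof -
    have "(\<integral>y. f (x + y) \<partial>N) = (\<integral>y. f (x + \<alpha> g y) \<partial>\<mu>)"
      by (intro int_N continuous_compose[OF f] continuous_intros)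
    also have "\<dots> = (\<integral>y. f (\<alpha> g (y + \<alpha> (- g) x)) \<partial>\<mu>)"
      by (simp add: act_hom act_inverse add.commute)
    also have "\<dots> = (\<integral>y. f (\<alpha> g y) \<partial>\<mu>)"
      by (rule integral_translate[OF continuous_act[OF f]])
    finally show ?thesis .
  qed
  have "(\<integral>x. \<integral>y. f (x + y) \<partial>N \<partial>\<mu>) = (\<integral>y. \<integral>x. f (x + y) \<partial>\<mu> \<partial>N)"
    by (rule Fubini_continuous[OF _ N]) (intro continuous_compose[OF f] continuous_intros)
  also have "\<dots> = (\<integral>y. (\<integral>x. f x \<partial>\<mu>) \<partial>N)"
    by (simp add: integral_translate[OF f])
  also have "\<dots> = (\<integral>x. f x \<partial>\<mu>)"
    using prob_space.prob_space[OF N(1)] by simp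
  finally show ?thesis
    using prob_space by (simp add: inner)
qed

text \<open>
  If \<open>\<xi>\<close> were fixed by some \<open>g \<noteq> 0\<close>, then \<open>{x. Re (\<xi> x) > 0}\<close> would be fixed by all multiples of \<open>g\<close>,
  and mixing gives it measure \<open>0\<close> or \<open>1\<close>. It is open and contains \<open>0\<close>, so the measure is \<open>1\<close>;
  this contradicts the vanishing of the integral of \<open>\<xi>\<close>.
\<close>

lemma character_stabilizer_trivial:
  assumes \<xi>: "character \<xi>" "\<xi> t \<noteq> 1" and fixed: "\<And>x. \<xi> (\<alpha> g x) = \<xi> x"
  shows "g = 0"
proof (rule ccontr)
  assume "g \<noteq> 0"
  then obtain i where i: "g $ i \<noteq> 0" by (auto simp: vec_eq_iff)
  define G where "G n = (\<chi> j. int n * g $ j)" for n :: nat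
  have "inj G"
  proof (rule injI)
    fix m n assume "G m = G n"
    then have "G m $ i = G n $ i" by simp
    then show "m = n" using i by (simp add: G_def)
  qed
  have G_Suc: "G (Suc n) = g + G n" for n
    by (simp add: G_def vec_eq_iff algebra_simps)
  have G_fixed: "\<xi> (\<alpha> (G n) x) = \<xi> x" for n x
  proof (induction n)
    case 0
    have "G 0 = 0" by (simp add: G_def vec_eq_iff)
    then show ?case by (simp add: act_0)
  next
    case (Suc n)
    then show ?case by (simp add: G_Suc act_add fixed)
  qed
  define A where "A = {x. 0 < Re (\<xi> x)}"
  have "open A"
    unfolding A_def by (intro open_Collect_less continuous_intros character_continuous \<xi>)
  then have A: "A \<in> sets \<mu>" by (simp add: sets_haar)
  have "0 \<in> A" by (simp add: A_def character_zero[OF \<xi>(1)])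
  then have pos: "measure \<mu> A > 0" using measure_open_pos[OF \<open>open A\<close>] by auto
  have GA: "\<alpha> (G n) ` A = A" for n
  proof (intro equalityI subsetI)
    fix x assume "x \<in> A"
    have "\<xi> (\<alpha> (- G n) x) = \<xi> x" using G_fixed[of n "\<alpha> (- G n) x"] by (simp add: act_inverse)
    then have "\<alpha> (- G n) x \<in> A" using \<open>x \<in> A\<close> by (simp add: A_def)
    then show "x \<in> \<alpha> (G n) ` A" by (intro image_eqI[of _ _ "\<alpha> (- G n) x"]) (simp_all add: act_inverse)
  qed (auto simp: A_def G_fixed)
  have "((\<lambda>g. measure \<mu> (A \<inter> \<alpha> g ` A)) \<longlongrightarrow> measure \<mu> A * measure \<mu> A) cofinite"
    using mix A unfolding mixing_def by blast
  moreover have "filterlim G cofinite sequentially"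
    unfolding filterlim_iff eventually_cofinite cofinite_eq_sequentially[symmetric]
  proof (intro allI impI)
    fix P :: "int ^ 'd \<Rightarrow> bool" assume "finite {x. \<not> P x}"
    from finite_vimageI[OF this \<open>inj G\<close>] show "finite {n. \<not> P (G n)}" by (simp add: vimage_def)
  qed
  ultimately have "(\<lambda>n. measure \<mu> (A \<inter> \<alpha> (G n) ` A)) \<longlonglongrightarrow> measure \<mu> A * measure \<mu> A"
    by (rule filterlim_compose)
  then have "measure \<mu> A = measure \<mu> A * measure \<mu> A"
    by (simp add: GA LIMSEQ_const_iff)
  then have "measure \<mu> A = 1" using pos by simp
  then have AE_pos: "AE x in \<mu>. x \<in> A" using prob_eq_1[OF A] by simp
  have "(\<integral>x. Re (\<xi> x) \<partial>\<mu>) = Re (\<integral>x. \<xi> x \<partial>\<mu>)"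
    by (intro integral_Re continuous_integrable character_continuous \<xi>)
  also have "\<dots> = 0" using integral_character[OF \<xi>] by simp
  finally have 0: "(\<integral>x. Re (\<xi> x) \<partial>\<mu>) = 0" .
  have "integrable \<mu> (\<lambda>x. Re (\<xi> x))"
    by (intro continuous_integrable continuous_intros character_continuous \<xi>)
  moreover have "AE x in \<mu>. 0 \<le> Re (\<xi> x)"
    using AE_pos by eventually_elim (simp add: A_def)
  ultimately have "AE x in \<mu>. Re (\<xi> x) = 0"
    using integral_nonneg_eq_0_iff_AE[of \<mu> "\<lambda>x. Re (\<xi> x)"] 0 by simp
  with AE_pos have "AE x in \<mu>. False"
    by eventually_elim (simp add: A_def)
  then show False by simp
qed

lemma character_orbit_inj:
  assumes \<xi>: "character \<xi>" "\<xi> t \<noteq> 1"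
  shows "inj (\<lambda>g x. \<xi> (\<alpha> g x))"
proof (rule injI)
  fix g h assume "(\<lambda>x. \<xi> (\<alpha> g x)) = (\<lambda>x. \<xi> (\<alpha> h x))"
  then have eq: "\<xi> (\<alpha> g x) = \<xi> (\<alpha> h x)" for x by (rule fun_cong)
  have "\<xi> (\<alpha> (g - h) x) = \<xi> x" for x
    using eq[of "\<alpha> (- h) x"] act_add[of g "- h" x] by (simp add: act_inverse)
  from character_stabilizer_trivial[OF \<xi> this] show "g = h" by simp
qed

text \<open>
  The coefficients \<open>c\<close> of \<open>h\<close> along the orbit of \<open>\<xi>\<close>, reflected and shifted, are orthogonal to all
  multiples of \<open>p\<close>, and these come arbitrarily close to the unit. Since the orbit is orthonormal,
  \<open>c 0\<close> is bounded by the norm of \<open>h\<close> times the distance in \<open>\<ell>\<^sup>2(\<int>\<^sup>d)\<close>.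
\<close>

lemma annihilated_coefficient_zero:
  fixes h :: "'a \<Rightarrow> complex" and p :: "int ^ 'd \<Rightarrow> real"
  assumes h: "continuous_on UNIV h"
    and S: "finite S" "\<And>v. v \<notin> S \<Longrightarrow> p v = 0" "p s \<noteq> 0"
    and ann: "\<And>x. (\<Sum>g\<in>S. p g * h (\<alpha> g x)) = 0"
    and \<xi>: "character \<xi>" "\<xi> t \<noteq> 1"
  shows "(\<integral>x. h x * cnj (\<xi> x) \<partial>\<mu>) = 0"
proof -
  define c where "c d = (\<integral>x. h x * cnj (\<xi> (\<alpha> d x)) \<partial>\<mu>)" for d
  have \<xi>c: "continuous_on UNIV (\<lambda>x. \<xi> (\<alpha> d x))" for d
    by (intro continuous_act character_continuous \<xi>)
  have ann_c: "(\<Sum>g\<in>S. p g * c (d - g)) = 0" for d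
  proof -
    have "c (d - g) = (\<integral>x. h (\<alpha> g x) * cnj (\<xi> (\<alpha> d x)) \<partial>\<mu>)" for g
    proof -
      have "continuous_on UNIV (\<lambda>x. h x * cnj (\<xi> (\<alpha> (d - g) x)))"
        by (intro continuous_intros h \<xi>c)
      from integral_act[OF this, of g] show ?thesis
        by (simp add: c_def act_add[symmetric])
    qed
    then have "(\<Sum>g\<in>S. p g * c (d - g)) = (\<Sum>g\<in>S. \<integral>x. p g * h (\<alpha> g x) * cnj (\<xi> (\<alpha> d x)) \<partial>\<mu>)"
      by (simp add: mult.assoc)
    also have "\<dots> = (\<integral>x. (\<Sum>g\<in>S. p g * h (\<alpha> g x) * cnj (\<xi> (\<alpha> d x))) \<partial>\<mu>)"
      by (intro Bochner_Integration.integral_sum[symmetric] continuous_integrable continuous_intros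
          continuous_act[OF h] \<xi>c)
    also have "\<dots> = 0"
      by (simp add: sum_distrib_right[symmetric] ann)
    finally show ?thesis .
  qed
  have small: "norm (c 0) \<le> l2norm h * sqrt e" if e: "e > 0" for e
  proof -
    obtain N I u a where N: "finite N" "finite I" "u \<in> N" "\<And>b g. b \<in> I \<Longrightarrow> g \<in> S \<Longrightarrow> b + g \<in> N"
      and le: "(\<Sum>v\<in>N. ((if v = u then 1 else 0) - (\<Sum>b\<in>I. a b * p (v - b)))\<^sup>2) \<le> e"
      by (rule unit_near_multiples[of S p s e, OF S(1) _ S(3) e]) (erule S(2), rule that)
    define r where "r v = (if v = u then 1 else 0) - (\<Sum>b\<in>I. a b * p (v - b))" for v
    have shifted: "(\<Sum>v\<in>N. p (v - b) * c (u - v)) = 0" if b: "b \<in> I" for b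
    proof -
      have "(\<Sum>v\<in>N. p (v - b) * c (u - v)) = (\<Sum>v\<in>(+) b ` S. p (v - b) * c (u - v))"
      proof (rule sum.mono_neutral_right)
        show "(+) b ` S \<subseteq> N" using N(4)[OF b] by auto
        show "\<forall>v\<in>N - (+) b ` S. complex_of_real (p (v - b)) * c (u - v) = 0"
        proof
          fix v assume "v \<in> N - (+) b ` S"
          then have "v - b \<notin> S" by (metis DiffD2 add_diff_cancel_left' diff_add_cancel image_eqI add.commute)
          then show "complex_of_real (p (v - b)) * c (u - v) = 0" using S(2) by simp
        qed
      qed (rule N)
      also have "\<dots> = (\<Sum>g\<in>S. p g * c (u - b - g))"
        by (subst sum.reindex) (auto simp: algebra_simps)
      also have "\<dots> = 0" by (rule ann_c)
      finally show ?thesis .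
    qed
    have "(\<Sum>v\<in>N. r v * c (u - v)) = (\<Sum>v\<in>N. if v = u then c 0 else 0)
        - (\<Sum>v\<in>N. \<Sum>b\<in>I. a b * (p (v - b) * c (u - v)))"
      unfolding sum_subtractf[symmetric]
      by (intro sum.cong refl) (auto simp: r_def left_diff_distrib sum_distrib_right mult.assoc)
    also have "(\<Sum>v\<in>N. \<Sum>b\<in>I. a b * (p (v - b) * c (u - v))) = (\<Sum>b\<in>I. a b * (\<Sum>v\<in>N. p (v - b) * c (u - v)))"
      by (subst sum.swap) (simp add: sum_distrib_left)
    also have "\<dots> = 0" using shifted by simp
    finally have c0: "c 0 = (\<Sum>v\<in>N. r v * c (u - v))" using N by simp
    define k where "k = (\<lambda>x. \<Sum>v\<in>N. complex_of_real (r v) * \<xi> (\<alpha> (u - v) x))"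
    have k: "continuous_on UNIV k"
      unfolding k_def by (intro continuous_intros \<xi>c)
    have "c 0 = (\<integral>x. h x * cnj (k x) \<partial>\<mu>)"
    proof -
      have "(\<Sum>v\<in>N. r v * c (u - v)) = (\<Sum>v\<in>N. \<integral>x. r v * (h x * cnj (\<xi> (\<alpha> (u - v) x))) \<partial>\<mu>)"
        by (simp add: c_def)
      also have "\<dots> = (\<integral>x. (\<Sum>v\<in>N. r v * (h x * cnj (\<xi> (\<alpha> (u - v) x)))) \<partial>\<mu>)"
        by (intro Bochner_Integration.integral_sum[symmetric] continuous_integrable continuous_intros h \<xi>c)
      also have "\<dots> = (\<integral>x. h x * cnj (k x) \<partial>\<mu>)"
        by (simp add: k_def sum_distrib_left mult_ac)
      finally show ?thesis using c0 by simp
    qed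
    then have "norm (c 0) \<le> l2norm h * l2norm k"
      using Cauchy_Schwarz[OF h continuous_on_cnj[OF k]] by simp
    also have "\<dots> \<le> l2norm h * sqrt e"
    proof (intro mult_left_mono l2norm_nonneg)
      have "inj_on (\<lambda>v x. \<xi> (\<alpha> (u - v) x)) N"
      proof (rule inj_onI)
        fix v w assume "(\<lambda>x. \<xi> (\<alpha> (u - v) x)) = (\<lambda>x. \<xi> (\<alpha> (u - w) x))"
        then have "u - v = u - w" by (rule injD[OF character_orbit_inj[OF \<xi>]])
        then show "v = w" by simp
      qed
      then have "(l2norm k)\<^sup>2 = (\<Sum>v\<in>N. (norm (complex_of_real (r v)))\<^sup>2)"
        unfolding k_def by (intro l2norm_character_sum N character_act \<xi>)
      also have "\<dots> \<le> e" using le unfolding r_def[symmetric] by (simp only: norm_of_real power2_abs)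
      finally show "l2norm k \<le> sqrt e" by (simp add: real_le_rsqrt)
    qed
    finally show ?thesis .
  qed
  have "norm (c 0) \<le> 0"
  proof (rule field_le_epsilon)
    fix e :: real assume "e > 0"
    define s where "s = e / (l2norm h + 1)"
    have "s > 0" using \<open>e > 0\<close> l2norm_nonneg[of h] by (simp add: s_def)
    then have "norm (c 0) \<le> l2norm h * s" using small[of "s\<^sup>2"] by simp
    also have "\<dots> \<le> e" using \<open>e > 0\<close> l2norm_nonneg[of h] by (simp add: s_def field_simps)
    finally show "norm (c 0) \<le> 0 + e" by simp
  qed
  then show ?thesis by (simp add: c_def act_0)
qed

text \<open>After subtracting the mean, \<open>h\<close> has no nonzero Fourier coefficient at all.\<close>

lemma annihilated_constant:
  fixes h :: "'a \<Rightarrow> complex" and p :: "int ^ 'd \<Rightarrow> real"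
  assumes h: "continuous_on UNIV h"
    and S: "finite S" "\<And>v. v \<notin> S \<Longrightarrow> p v = 0" "p s \<noteq> 0"
    and ann: "\<And>x. (\<Sum>g\<in>S. p g * h (\<alpha> g x)) = 0"
  shows "h x = (\<integral>y. h y \<partial>\<mu>)"
proof (rule ccontr)
  assume ne: "h x \<noteq> (\<integral>y. h y \<partial>\<mu>)"
  define m where "m = (\<integral>y. h y \<partial>\<mu>)"
  define k where "k = (\<lambda>y. h y - m)"
  have k: "continuous_on UNIV k" unfolding k_def by (intro continuous_intros h)
  have "k x \<noteq> 0" using ne by (simp add: k_def m_def)
  then obtain \<xi> where \<xi>: "character \<xi>" "(\<integral>x. k x * cnj (\<xi> x) \<partial>\<mu>) \<noteq> 0"
    using nonzero_coefficient[OF k] by blast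
  have c1: "continuous_on UNIV (\<lambda>x. h x * cnj (\<xi> x))" "continuous_on UNIV (\<lambda>x. m * cnj (\<xi> x))"
    by (intro continuous_intros h character_continuous \<xi>)+
  have eq: "(\<integral>x. k x * cnj (\<xi> x) \<partial>\<mu>) = (\<integral>x. h x * cnj (\<xi> x) \<partial>\<mu>) - m * (\<integral>x. cnj (\<xi> x) \<partial>\<mu>)"
    using integral_diff_continuous[OF c1] by (simp add: k_def left_diff_distrib)
  show False
  proof (cases "\<forall>t. \<xi> t = 1")
    case True
    then show False using eq \<xi>(2) prob_space by (simp add: m_def)
  next
    case False
    then obtain t where t: "\<xi> t \<noteq> 1" by blast
    have "(\<integral>x. cnj (\<xi> x) \<partial>\<mu>) = 0"
      using integral_character[OF character_cnj[OF \<xi>(1)], of t] t by (metis complex_cnj_cnj complex_cnj_one)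
    then show False
      using eq \<xi>(2) annihilated_coefficient_zero[where p = p and S = S, OF h S(1) S(2) S(3) ann \<xi>(1) t] by simp
  qed
qed

end


section \<open>Independent characters and entropy\<close>

context compact_abelian_haar
begin

text \<open>
  After rotating the targets to \<open>1\<close>, integrate the square of \<open>\<bar>\<Prod> (1 + m\<^sub>g)\<^sup>N\<bar>\<close>. By orthogonality of the
  monomials the integral is a product of central binomial coefficients, of size \<open>4\<close> to the power
  \<open>N \<bar>Q\<bar>\<close> up to a polynomial factor. If every point missed some target, the integrand would be
  exponentially smaller than that.
\<close>

lemma independent_characters_dense:
  fixes m :: "'i \<Rightarrow> 'a \<Rightarrow> complex"
  assumes Q: "finite Q" and m: "\<And>g. g \<in> Q \<Longrightarrow> character (m g)"
    and indep: "\<And>\<phi> \<psi> :: 'i \<Rightarrow> nat. (\<And>x. (\<Prod>g\<in>Q. m g x ^ \<phi> g) = (\<Prod>g\<in>Q. m g x ^ \<psi> g)) \<Longrightarrow> \<forall>g\<in>Q. \<phi> g = \<psi> g"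
    and w: "\<And>g. norm (w g) = 1" and \<rho>: "\<rho> > 0"
  shows "\<exists>x. \<forall>g\<in>Q. dist (m g x) (w g) < \<rho>"
proof (rule ccontr)
  assume "\<not> ?thesis"
  then have bad: "\<exists>g\<in>Q. \<rho> \<le> dist (m g x) (w g)" for x by (auto simp: not_less)
  then have Qne: "Q \<noteq> {}" by auto
  define q where "q = card Q"
  have q: "q > 0" using Q Qne by (simp add: q_def card_gt_0_iff)
  define z where "z g x = m g x * cnj (w g)" for g x
  have z_norm: "norm (z g x) = 1" if "g \<in> Q" for g x
    using character_norm[OF m[OF that]] w by (simp add: z_def norm_mult)
  have z_dist: "norm (z g x - 1) = dist (m g x) (w g)" for g x
  proof -
    have "z g x - 1 = (m g x - w g) * cnj (w g)"
      using w[of g] by (simp add: z_def left_diff_distrib complex_norm_square[symmetric])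
    then show ?thesis by (simp add: norm_mult w dist_norm)
  qed
  have z_plus: "(norm (1 + z g x))\<^sup>2 = 4 - (dist (m g x) (w g))\<^sup>2" if "g \<in> Q" for g x
  proof -
    have "(norm (1 + z g x))\<^sup>2 + (norm (z g x - 1))\<^sup>2 = 2 + 2 * (norm (z g x))\<^sup>2"
      unfolding cmod_power2 by (simp add: power2_eq_square algebra_simps)
    then show ?thesis using z_norm[OF that] by (simp add: z_dist)
  qed
  \<comment> \<open>A missed target reduces the maximal value \<open>4\<close> of \<open>\<bar>1 + z g x\<bar>\<^sup>2\<close> by at least the factor \<open>\<beta>\<close>.\<close>
  define \<beta> where "\<beta> = (4 - \<rho>\<^sup>2) / 4"
  have \<beta>0: "\<beta> \<ge> 0"
  proof -
    obtain g where g: "g \<in> Q" "\<rho> \<le> dist (m g 0) (w g)" using bad by blast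
    have "\<rho>\<^sup>2 \<le> (dist (m g 0) (w g))\<^sup>2" using g \<rho> by (intro power_mono) auto
    also have "\<dots> \<le> 4" using z_plus[OF g(1), of 0] by (metis diff_ge_0_iff_ge zero_le_power2)
    finally show ?thesis by (simp add: \<beta>_def)
  qed
  have \<beta>1: "\<beta> < 1" using \<rho> by (simp add: \<beta>_def)
  define F where "F N x = (\<Prod>g\<in>Q. (1 + z g x) ^ N)" for N x
  define r where "r N f = (\<Prod>g\<in>Q. of_nat (N choose f g) * cnj (w g) ^ f g)" for N and f :: "'i \<Rightarrow> nat"
  define \<xi> where "\<xi> f x = (\<Prod>g\<in>Q. m g x ^ f g)" for f :: "'i \<Rightarrow> nat" and x
  have F_expand: "F N x = (\<Sum>f\<in>Q \<rightarrow>\<^sub>E {..N}. r N f * \<xi> f x)" for N x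
  proof -
    have "F N x = (\<Prod>g\<in>Q. \<Sum>k\<le>N. of_nat (N choose k) * z g x ^ k)"
      unfolding F_def by (intro prod.cong refl) (simp add: add.commute[of 1] binomial_ring)
    also have "\<dots> = (\<Sum>f\<in>Q \<rightarrow>\<^sub>E {..N}. \<Prod>g\<in>Q. of_nat (N choose f g) * z g x ^ f g)"
      using Q by (intro prod_sum_PiE) auto
    also have "\<dots> = (\<Sum>f\<in>Q \<rightarrow>\<^sub>E {..N}. r N f * \<xi> f x)"
      unfolding r_def \<xi>_def prod.distrib[symmetric]
      by (intro sum.cong prod.cong refl) (simp add: z_def power_mult_distrib mult_ac)
    finally show ?thesis .
  qed
  have F_char: "(l2norm (F N))\<^sup>2 = (real ((2 * N) choose N)) ^ q" for N
  proof -
    have "(l2norm (F N))\<^sup>2 = (\<Sum>f\<in>Q \<rightarrow>\<^sub>E {..N}. (norm (r N f))\<^sup>2)"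
      unfolding F_expand[abs_def]
    proof (rule l2norm_character_sum)
      show "finite (Q \<rightarrow>\<^sub>E {..N})" using Q by (intro finite_PiE) auto
      show "character (\<xi> f)" for f
        unfolding \<xi>_def using m by (intro character_prod character_power)
      show "inj_on \<xi> (Q \<rightarrow>\<^sub>E {..N})"
      proof (rule inj_onI)
        fix f f' assume f: "f \<in> Q \<rightarrow>\<^sub>E {..N}" "f' \<in> Q \<rightarrow>\<^sub>E {..N}" and "\<xi> f = \<xi> f'"
        then have "\<xi> f x = \<xi> f' x" for x by simp
        then have "\<forall>g\<in>Q. f g = f' g" unfolding \<xi>_def by (rule indep)
        then show "f = f'" using PiE_ext[OF f] by blast
      qed
    qed
    also have "\<dots> = (\<Sum>f\<in>Q \<rightarrow>\<^sub>E {..N}. \<Prod>g\<in>Q. (real (N choose f g))\<^sup>2)"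
    proof (intro sum.cong refl)
      fix f
      have "norm (r N f) = (\<Prod>g\<in>Q. real (N choose f g))"
        unfolding r_def prod_norm[symmetric] by (simp add: norm_mult norm_power w)
      then show "(norm (r N f))\<^sup>2 = (\<Prod>g\<in>Q. (real (N choose f g))\<^sup>2)"
        by (simp add: prod_power_distrib)
    qed
    also have "\<dots> = (\<Prod>g\<in>Q. \<Sum>k\<le>N. (real (N choose k))\<^sup>2)"
      using Q by (intro prod_sum_PiE[symmetric]) auto
    also have "(\<Sum>k\<le>N. (real (N choose k))\<^sup>2) = real ((2 * N) choose N)"
      unfolding choose_square_sum[of N, symmetric] by simp
    finally show ?thesis by (simp add: q_def)
  qed
  have F_cont: "continuous_on UNIV (F N)" for N
    unfolding F_def z_def using m by (intro continuous_intros character_continuous)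
  have F_le: "(norm (F N x))\<^sup>2 \<le> 4 ^ (N * q) * \<beta> ^ N" for N x
  proof -
    obtain g where g: "g \<in> Q" "\<rho> \<le> dist (m g x) (w g)" using bad by blast
    have "(norm (F N x))\<^sup>2 = (\<Prod>g\<in>Q. ((norm (1 + z g x))\<^sup>2) ^ N)"
      by (simp add: F_def prod_norm[symmetric] norm_power prod_power_distrib power_mult[symmetric] mult.commute)
    also have "\<dots> = ((norm (1 + z g x))\<^sup>2) ^ N * (\<Prod>g\<in>Q - {g}. ((norm (1 + z g x))\<^sup>2) ^ N)"
      by (rule prod.remove[OF Q g(1)])
    also have "\<dots> \<le> (4 * \<beta>) ^ N * (\<Prod>g\<in>Q - {g}. 4 ^ N)"
    proof (intro mult_mono prod_mono conjI power_mono prod_nonneg)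
      have "\<rho>\<^sup>2 \<le> (dist (m g x) (w g))\<^sup>2" using g \<rho> by (intro power_mono) auto
      then show "(norm (1 + z g x))\<^sup>2 \<le> 4 * \<beta>"
        using z_plus[OF g(1), of x] by (simp add: \<beta>_def)
      show "(norm (1 + z g' x))\<^sup>2 \<le> 4" if "g' \<in> Q - {g}" for g'
        using z_plus[of g' x] that by simp
    qed (use \<beta>0 in auto)
    also have "(\<Prod>g\<in>Q - {g}. 4 ^ N) = (4 ^ N) ^ (q - 1)"
      using g(1) Q by (simp add: q_def)
    also have "(4 * \<beta>) ^ N * (4 ^ N) ^ (q - 1) = (4 ^ N * (4 ^ N) ^ (q - 1)) * \<beta> ^ N"
      by (simp add: power_mult_distrib)
    also have "4 ^ N * (4 ^ N) ^ (q - 1) = ((4 :: real) ^ N) ^ q"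
      using q by (metis Suc_diff_1 power_Suc)
    finally show ?thesis by (simp add: power_mult)
  qed
  have key: "1 \<le> (2 * real N) ^ q * \<beta> ^ N" if N: "N > 0" for N
  proof -
    have "(4 ^ N / (2 * real N)) ^ q \<le> (real ((2 * N) choose N)) ^ q"
      using central_binomial_lower_bound[OF N] by (intro power_mono) auto
    also have "\<dots> = (l2norm (F N))\<^sup>2" by (rule F_char[symmetric])
    also have "\<dots> \<le> (sqrt (4 ^ (N * q) * \<beta> ^ N))\<^sup>2"
      by (intro power_mono l2norm_le F_cont real_le_rsqrt F_le l2norm_nonneg)
    also have "\<dots> = 4 ^ (N * q) * \<beta> ^ N" using \<beta>0 by simp
    finally have "4 ^ (N * q) \<le> 4 ^ (N * q) * ((2 * real N) ^ q * \<beta> ^ N)"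
      using N by (simp add: power_divide power_mult field_simps)
    then show ?thesis by simp
  qed
  define \<gamma> where "\<gamma> = root q \<beta>"
  have \<gamma>: "0 \<le> \<gamma>" "\<gamma> < 1" "\<gamma> ^ q = \<beta>"
    using q \<beta>0 \<beta>1 by (simp_all add: \<gamma>_def)
  have "(\<lambda>N. 2 * (of_nat N * \<gamma> ^ N)) \<longlonglongrightarrow> 2 * 0"
    using \<gamma> by (intro tendsto_mult_left powser_times_n_limit_0) auto
  then have "(\<lambda>N. (2 * (real N * \<gamma> ^ N)) ^ q) \<longlonglongrightarrow> (2 * 0) ^ q"
    by (rule tendsto_power)
  moreover have "(2 * (real N * \<gamma> ^ N)) ^ q = (2 * real N) ^ q * \<beta> ^ N" for N
    by (simp add: power_mult_distrib \<gamma>(3)[symmetric] power_mult[symmetric] mult_ac)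
  ultimately have lim: "(\<lambda>N. (2 * real N) ^ q * \<beta> ^ N) \<longlonglongrightarrow> 0"
    by (simp only: mult_zero_right zero_power[OF q])
  have "\<forall>N\<ge>1. 1 \<le> (2 * real N) ^ q * \<beta> ^ N" using key by simp
  then have "1 \<le> (0 :: real)"
    by (intro LIMSEQ_le_const[OF lim]) (rule exI)
  then show False by simp
qed

end

lemma cover_number_irredundant:
  assumes "finite J" "\<Union>J = UNIV" and own: "\<And>A. A \<in> J \<Longrightarrow> \<exists>x\<in>A. \<forall>B\<in>J. x \<in> B \<longrightarrow> B = A"
  shows "cover_number J = card J"
proof -
  have "V = J" if V: "V \<subseteq> J" "\<Union>V = UNIV" for V
  proof (intro equalityI subsetI)
    fix A assume "A \<in> J"
    then obtain x where x: "x \<in> A" "\<forall>B\<in>J. x \<in> B \<longrightarrow> B = A" using own by blast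
    obtain B where "B \<in> V" "x \<in> B" using V(2) by blast
    then show "A \<in> V" using x V(1) by blast
  qed (use V in auto)
  then have "{card V | V. V \<subseteq> J \<and> finite V \<and> \<Union>V = UNIV} = {card J}"
    using assms by blast
  then show ?thesis by (simp add: cover_number_def)
qed

lemma separated_circle_points:
  fixes k :: nat
  obtains w :: "nat \<Rightarrow> complex" and \<rho> where "\<And>i. norm (w i) = 1" "\<rho> > 0"
    "\<And>i j. i < k \<Longrightarrow> j < k \<Longrightarrow> i \<noteq> j \<Longrightarrow> 2 * \<rho> < dist (w i) (w j)"
proof -
  \<comment> \<open>For \<open>i < k\<close> the angles lie in \<open>[0, 1]\<close>, where the cosine is injective.\<close>
  define w where "w i = cis (real i / real (Suc k))" for i
  \<comment> \<open>The number \<open>1\<close> keeps the set nonempty when there are no pairs of points.\<close>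
  define D where "D = insert 1 ((\<lambda>(i, j). dist (w i) (w j)) ` {(i, j). i < k \<and> j < k \<and> i \<noteq> j})"
  have "finite {(i, j). i < k \<and> j < k \<and> i \<noteq> j}"
    by (rule finite_subset[of _ "{..<k} \<times> {..<k}"]) auto
  then have D: "finite D" "D \<noteq> {}" by (auto simp: D_def)
  have ne: "w i \<noteq> w j" if "i < k" "j < k" "i \<noteq> j" for i j
  proof
    assume "w i = w j"
    then have eq: "cos (real i / real (Suc k)) = cos (real j / real (Suc k))"
      by (simp add: w_def complex_eq_iff)
    have le: "real l / real (Suc k) \<le> pi" if "l < k" for l
    proof -
      have "real l / real (Suc k) \<le> 1" using that by simp
      then show ?thesis using pi_gt3 by linarith
    qed
    have "real i / real (Suc k) = real j / real (Suc k)"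
      by (rule cos_inj_pi[OF _ le[OF that(1)] _ le[OF that(2)] eq]) simp_all
    then show False using that by simp
  qed
  have "0 < Min D" using D ne by (subst Min_gr_iff) (auto simp: D_def)
  show ?thesis
  proof (rule that[of w "Min D / 3"])
    show "norm (w i) = 1" for i by (simp add: w_def)
    show "Min D / 3 > 0" using \<open>0 < Min D\<close> by simp
    fix i j assume "i < k" "j < k" "i \<noteq> j"
    then have "dist (w i) (w j) \<in> D" by (auto simp: D_def)
    then have "Min D \<le> dist (w i) (w j)" using D by simp
    then show "2 * (Min D / 3) < dist (w i) (w j)" using \<open>0 < Min D\<close> by simp
  qed
qed

lemma cube_card: "card (cube n :: (int ^ 'd::finite) set) = n ^ CARD('d)" "finite (cube n :: (int ^ 'd) set)"
  unfolding cube_def using box_card[of 0 "int n"] box_finite[of 0 "int n"] by simp_all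

context mixing_action
begin

text \<open>
  Around \<open>k\<close> points of the circle take disjoint small discs, and cover the circle by the \<open>k\<close>
  sets each omitting all discs but one. Pulled back along the orbit of an independent character,
  every member of the joined cover contains a point lying in no other member, so that the
  cover numbers are exactly \<open>k\<close> to the power of the volume.
\<close>

lemma entropy_ge_ln:
  assumes m: "character m"
    and indep: "\<And>Q \<phi> \<psi>. finite Q \<Longrightarrow> (\<And>x. (\<Prod>g\<in>Q. m (\<alpha> g x) ^ \<phi> g) = (\<Prod>g\<in>Q. m (\<alpha> g x) ^ \<psi> g))
      \<Longrightarrow> \<forall>g\<in>Q. \<phi> g = (\<psi> g :: nat)"
    and k: "k > 0"
  shows "ereal (ln (real k)) \<le> topological_entropy \<alpha>"
proof -
  obtain w :: "nat \<Rightarrow> complex" and \<rho> where w: "\<And>i. norm (w i) = 1" and \<rho>: "\<rho> > 0"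
    and sep: "\<And>i j. i < k \<Longrightarrow> j < k \<Longrightarrow> i \<noteq> j \<Longrightarrow> 2 * \<rho> < dist (w i) (w j)"
    using separated_circle_points by blast
  define V where "V j = {x. \<forall>i\<in>{..<k} - {j}. \<rho> < dist (m x) (w i)}" for j
  define U where "U = V ` {..<k}"
  have mc: "continuous_on UNIV m" by (rule character_continuous[OF m])
  have V_open: "open (V j)" for j
  proof -
    have "V j = (\<Inter>i\<in>{..<k} - {j}. {x. \<rho> < dist (m x) (w i)})" by (auto simp: V_def)
    also have "open \<dots>" by (intro open_INT ballI open_Collect_less continuous_intros mc) auto
    finally show ?thesis .
  qed
  have V_cover: "\<exists>j<k. x \<in> V j" for x
  proof (cases "\<exists>j<k. dist (m x) (w j) \<le> \<rho>")
    case True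
    then obtain j where j: "j < k" "dist (m x) (w j) \<le> \<rho>" by blast
    have "\<rho> < dist (m x) (w i)" if "i < k" "i \<noteq> j" for i
      using sep[OF that(1) j(1) that(2)] j(2) dist_triangle[of "w i" "w j" "m x"]
      by (simp add: dist_commute)
    then show ?thesis using j(1) by (auto simp: V_def)
  next
    case False
    then show ?thesis using k by (intro exI[of _ 0]) (auto simp: V_def not_le)
  qed
  have U: "finite_open_cover U"
    unfolding finite_open_cover_def U_def using V_open V_cover by auto
  have number: "cover_number (join_cover \<alpha> (cube n) U) = k ^ (n ^ CARD('d))" for n
  proof -
    define Q where "Q = (cube n :: (int ^ 'd) set)"
    have Q: "finite Q" "card Q = n ^ CARD('d)" by (simp_all add: Q_def cube_card)
    define E where "E = Q \<rightarrow>\<^sub>E {..<k}"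
    define T where "T f = (\<Inter>g\<in>Q. \<alpha> g -` V (f g))" for f
    have J: "join_cover \<alpha> Q U = T ` E"
    proof (intro equalityI subsetI)
      fix A assume "A \<in> join_cover \<alpha> Q U"
      then obtain f where f: "A = (\<Inter>g\<in>Q. \<alpha> g -` f g)" "\<forall>g\<in>Q. f g \<in> U"
        unfolding join_cover_def by blast
      then have "\<forall>g\<in>Q. \<exists>j<k. f g = V j" by (auto simp: U_def)
      then obtain j where j: "\<forall>g\<in>Q. j g < k \<and> f g = V (j g)" by metis
      then have "A = T (restrict j Q)" using f(1) by (auto simp: T_def)
      moreover have "restrict j Q \<in> E" using j by (auto simp: E_def)
      ultimately show "A \<in> T ` E" by blast
    next
      fix A assume "A \<in> T ` E"
      then obtain f where f: "f \<in> E" "A = T f" by blast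
      then have "\<forall>g\<in>Q. V (f g) \<in> U" by (auto simp: E_def U_def PiE_def Pi_def)
      then show "A \<in> join_cover \<alpha> Q U"
        unfolding join_cover_def f(2) T_def by (intro CollectI exI[of _ "\<lambda>g. V (f g)"] conjI refl)
    qed
    have "\<exists>x\<in>T f. \<forall>f'\<in>E. x \<in> T f' \<longrightarrow> f' = f" if f: "f \<in> E" for f
    proof -
      have "\<exists>x. \<forall>g\<in>Q. dist (m (\<alpha> g x)) (w (f g)) < \<rho>"
        by (rule independent_characters_dense[OF Q(1) character_act[OF m] indep[OF Q(1)] w \<rho>])
      then obtain x where x: "\<And>g. g \<in> Q \<Longrightarrow> dist (m (\<alpha> g x)) (w (f g)) < \<rho>" by blast
      have fk: "f g < k" if "g \<in> Q" for g using f that by (auto simp: E_def)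
      have "x \<in> T f"
        unfolding T_def V_def
      proof (intro INT_I vimageI2 CollectI ballI)
        fix g i assume "g \<in> Q" "i \<in> {..<k} - {f g}"
        then show "\<rho> < dist (m (\<alpha> g x)) (w i)"
          using sep[of i "f g"] fk[of g] x[of g] dist_triangle[of "w i" "w (f g)" "m (\<alpha> g x)"]
          by (simp add: dist_commute)
      qed
      moreover have "f' = f" if f': "f' \<in> E" "x \<in> T f'" for f'
      proof (rule PiE_ext[OF f'(1)[unfolded E_def] f[unfolded E_def]])
        fix g assume g: "g \<in> Q"
        show "f' g = f g"
        proof (rule ccontr)
          assume "f' g \<noteq> f g"
          then have "\<rho> < dist (m (\<alpha> g x)) (w (f g))"
            using f'(2) g fk[OF g] by (auto simp: T_def V_def)
          then show False using x[OF g] by simp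
        qed
      qed
      ultimately show ?thesis by blast
    qed
    then obtain y where y: "\<And>f. f \<in> E \<Longrightarrow> y f \<in> T f" "\<And>f f'. f \<in> E \<Longrightarrow> f' \<in> E \<Longrightarrow> y f \<in> T f' \<Longrightarrow> f' = f"
      by metis
    have "inj_on T E"
    proof (rule inj_onI)
      fix f f' assume "f \<in> E" "f' \<in> E" "T f = T f'"
      then show "f = f'" using y by metis
    qed
    then have card_J: "card (T ` E) = k ^ (n ^ CARD('d))"
      using Q by (simp add: card_image E_def card_PiE)
    have "cover_number (T ` E) = card (T ` E)"
    proof (rule cover_number_irredundant)
      show "finite (T ` E)" unfolding E_def using Q by (intro finite_imageI finite_PiE) auto
      show "\<Union>(T ` E) = UNIV"
      proof (intro equalityI subsetI UNIV_I)
        fix x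
        have "\<forall>g. \<exists>i. i < k \<and> \<alpha> g x \<in> V i" using V_cover by blast
        then obtain j where j: "\<And>g. j g < k \<and> \<alpha> g x \<in> V (j g)" by metis
        have "x \<in> T (restrict j Q)" using j by (auto simp: T_def)
        moreover have "restrict j Q \<in> E" using j by (auto simp: E_def)
        ultimately show "x \<in> \<Union>(T ` E)" by blast
      qed
      show "\<exists>x\<in>A. \<forall>B\<in>T ` E. x \<in> B \<longrightarrow> B = A" if A: "A \<in> T ` E" for A
      proof -
        from A obtain f where f: "f \<in> E" "A = T f" by blast
        have "\<forall>B\<in>T ` E. y f \<in> B \<longrightarrow> B = A" using y(2)[OF f(1)] f(2) by blast
        then show ?thesis using y(1)[OF f(1)] f(2) by blast
      qed
    qed
    then show ?thesis using J card_J by (simp add: Q_def)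
  qed
  have "(\<lambda>n. ln (real (cover_number (join_cover \<alpha> (cube n) U))) / real n ^ CARD('d)) \<longlonglongrightarrow> ln (real k)"
  proof (rule tendsto_eventually, rule eventually_sequentiallyI[of 1])
    fix n :: nat assume "1 \<le> n"
    then show "ln (real (cover_number (join_cover \<alpha> (cube n) U))) / real n ^ CARD('d) = ln (real k)"
      using k by (simp add: number ln_realpow)
  qed
  then have "lim (\<lambda>n. ln (real (cover_number (join_cover \<alpha> (cube n) U))) / real n ^ CARD('d)) = ln (real k)"
    by (rule limI)
  then show ?thesis
    unfolding topological_entropy_def using U by (intro SUP_upper2[of U]) auto
qed

text \<open>Otherwise the entropy would be at least \<open>ln k\<close> for every \<open>k\<close>.\<close>

lemma character_orbit_dependent:
  assumes ent: "topological_entropy \<alpha> < \<infinity>" and m: "character m"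
  obtains Q \<phi> \<psi> where "finite Q" "\<And>x. (\<Prod>g\<in>Q. m (\<alpha> g x) ^ \<phi> g) = (\<Prod>g\<in>Q. m (\<alpha> g x) ^ \<psi> g)"
    "\<exists>g\<in>Q. \<phi> g \<noteq> (\<psi> g :: nat)"
proof (rule ccontr)
  note witness = that
  assume "\<not> thesis"
  then have indep: "\<forall>g\<in>Q. \<phi> g = \<psi> g"
    if "finite Q" "\<And>x. (\<Prod>g\<in>Q. m (\<alpha> g x) ^ \<phi> g) = (\<Prod>g\<in>Q. m (\<alpha> g x) ^ \<psi> g)"
    for Q and \<phi> \<psi> :: "int ^ 'd \<Rightarrow> nat"
    using witness[of Q \<phi> \<psi>] that \<open>\<not> thesis\<close> by blast
  obtain r where r: "topological_entropy \<alpha> \<le> ereal r"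
    using ent by (cases "topological_entropy \<alpha>") auto
  define k where "k = nat \<lceil>exp (r + 1)\<rceil>"
  have k: "exp (r + 1) \<le> real k" unfolding k_def by (rule real_nat_ceiling_ge)
  then have "k > 0" using exp_gt_zero[of "r + 1"] by linarith
  have "r + 1 \<le> ln (real k)" using k \<open>k > 0\<close> by (simp add: ln_ge_iff)
  moreover have "ereal (ln (real k)) \<le> ereal r"
    using entropy_ge_ln[OF m indep \<open>k > 0\<close>] r by (rule order_trans)
  ultimately show False by simp
qed

end


section \<open>Rigidity of equivariant maps\<close>

locale connected_mixing_action = mixing_action \<mu> \<alpha> + connected_abelian_haar \<mu>
  for \<mu> :: "'a::topological_ab_group_add measure" and \<alpha> :: "int ^ 'd::finite \<Rightarrow> 'a \<Rightarrow> 'a" +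
  assumes entropy: "topological_entropy \<alpha> < \<infinity>"
begin

lemma cis_sum: "finite A \<Longrightarrow> cis (\<Sum>i\<in>A. f i) = (\<Prod>i\<in>A. cis (f i))"
  by (induction A rule: finite_induct) (simp_all add: cis_mult[symmetric])

text \<open>
  In the decomposition of \<open>m \<circ> \<tau>\<close> the real function \<open>h\<close> satisfies the additive form of the
  multiplicative relation among the translates of \<open>m\<close>, because a nontrivial character has no
  continuous logarithm. Mixing then forces \<open>h = 0\<close>.
\<close>

lemma character_of_equivariant_map:
  assumes \<tau>: "continuous_on UNIV \<tau>" "equivariant \<alpha> \<tau>" and m: "character m"
  shows "m (\<tau> (x + y)) * m (\<tau> 0) = m (\<tau> x) * m (\<tau> y)"
proof -
  note mc = character_continuous[OF m]
  have "continuous_on UNIV (\<lambda>x. m (\<tau> x))" by (rule continuous_compose[OF mc \<tau>(1)])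
  then obtain \<theta> h where \<theta>: "character \<theta>" and h: "continuous_on UNIV h" "h 0 = (0::real)"
    and eq: "\<And>x. m (\<tau> x) = m (\<tau> 0) * \<theta> x * cis (h x)"
    using circle_map_decomposition[of "\<lambda>x. m (\<tau> x)"] character_norm[OF m] by metis
  obtain Q \<phi> \<psi> where Q: "finite Q"
    and rel: "\<And>x. (\<Prod>g\<in>Q. m (\<alpha> g x) ^ \<phi> g) = (\<Prod>g\<in>Q. m (\<alpha> g x) ^ \<psi> g)"
    and ne: "\<exists>g\<in>Q. \<phi> g \<noteq> (\<psi> g :: nat)"
    by (rule character_orbit_dependent[OF entropy m]) (rule that)
  define P where "P f x = (\<Prod>g\<in>Q. \<theta> (\<alpha> g x) ^ f g)" for f :: "int ^ 'd \<Rightarrow> nat" and x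
  have P: "character (P f)" for f
    unfolding P_def by (intro character_prod character_power character_act \<theta>)
  define H where "H f x = (\<Sum>g\<in>Q. real (f g) * h (\<alpha> g x))" for f :: "int ^ 'd \<Rightarrow> nat" and x
  have Hc: "continuous_on UNIV (H f)" for f
    unfolding H_def by (intro continuous_intros continuous_act h)
  define K where "K f = (\<Prod>g\<in>Q. m (\<tau> 0) ^ f g)" for f :: "int ^ 'd \<Rightarrow> nat"
  have K_nz: "K f \<noteq> 0" for f unfolding K_def using Q character_nonzero[OF m] by simp
  have expand: "(\<Prod>g\<in>Q. m (\<alpha> g (\<tau> x)) ^ f g) = K f * P f x * cis (H f x)" for f x
  proof -
    have "m (\<alpha> g (\<tau> x)) ^ f g = m (\<tau> 0) ^ f g * \<theta> (\<alpha> g x) ^ f g * cis (real (f g) * h (\<alpha> g x))" for g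
    proof -
      have "m (\<alpha> g (\<tau> x)) = m (\<tau> (\<alpha> g x))" using \<tau>(2) by (simp add: equivariant_def)
      also have "\<dots> = m (\<tau> 0) * \<theta> (\<alpha> g x) * cis (h (\<alpha> g x))" by (rule eq)
      finally show ?thesis by (simp only: power_mult_distrib Complex.DeMoivre)
    qed
    then show ?thesis
      by (simp add: prod.distrib K_def P_def H_def cis_sum[OF Q])
  qed
  have rel': "K \<phi> * P \<phi> x * cis (H \<phi> x) = K \<psi> * P \<psi> x * cis (H \<psi> x)" for x
    using rel[of "\<tau> x"] by (simp only: expand)
  have H0: "H f 0 = 0" for f by (simp add: H_def act_zero h)
  have "K \<phi> = K \<psi>" using rel'[of 0] by (simp add: H0 character_zero[OF P])
  then have PH: "P \<phi> x * cis (H \<phi> x) = P \<psi> x * cis (H \<psi> x)" for x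
    using rel'[of x] K_nz by simp
  define L where "L x = H \<phi> x - H \<psi> x" for x
  have L_char: "cis (L x) = P \<psi> x * cnj (P \<phi> x)" for x
  proof -
    have "cis (H \<phi> x) = (P \<phi> x * cnj (P \<phi> x)) * cis (H \<phi> x)"
      by (simp only: character_mult_cnj[OF P] mult_1)
    also have "\<dots> = cnj (P \<phi> x) * (P \<phi> x * cis (H \<phi> x))"
      by (simp only: mult_ac)
    also have "\<dots> = P \<psi> x * cnj (P \<phi> x) * cis (H \<psi> x)"
      by (simp only: PH mult_ac)
    finally show ?thesis
      by (simp add: L_def cis_divide[symmetric])
  qed
  have L0: "L x = 0" for x
  proof (rule additive_logarithm_zero)
    show "continuous_on UNIV L" unfolding L_def by (intro continuous_intros Hc)
    show "L 0 = 0" by (simp add: L_def H0)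
    show "cis (L (x + y)) = cis (L x) * cis (L y)" for x y
      by (simp add: L_char character_add[OF P])
  qed
  define p where "p g = (if g \<in> Q then real (\<phi> g) - real (\<psi> g) else 0)" for g
  obtain s where "s \<in> Q" "\<phi> s \<noteq> \<psi> s" using ne by blast
  then have s: "p s \<noteq> 0" by (simp add: p_def)
  have "h x = 0" for x
  proof -
    have hc: "continuous_on UNIV (\<lambda>x. complex_of_real (h x))" by (intro continuous_intros h)
    have p0: "p v = 0" if "v \<notin> Q" for v using that by (simp add: p_def)
    have "(\<Sum>g\<in>Q. complex_of_real (p g) * complex_of_real (h (\<alpha> g x))) = complex_of_real (L x)" for x
      by (simp add: L_def H_def p_def left_diff_distrib sum_subtractf)
    then have ann: "(\<Sum>g\<in>Q. complex_of_real (p g) * complex_of_real (h (\<alpha> g x))) = 0" for x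
      by (simp add: L0)
    have "complex_of_real (h x) = complex_of_real (h 0)"
      using annihilated_constant[where p = p and S = Q, OF hc Q p0 s ann, of x]
        annihilated_constant[where p = p and S = Q, OF hc Q p0 s ann, of 0] by simp
    then show ?thesis using h(2) by simp
  qed
  then have eq': "m (\<tau> x) = m (\<tau> 0) * \<theta> x" for x using eq[of x] by simp
  show ?thesis
    by (simp only: eq'[of x] eq'[of y] eq'[of "x + y"] character_add[OF \<theta>] mult_ac)
qed

theorem equivariant_map_affine:
  assumes \<tau>: "continuous_on UNIV \<tau>" "equivariant \<alpha> \<tau>"
  shows "\<tau> (x + y) - \<tau> 0 = (\<tau> x - \<tau> 0) + (\<tau> y - \<tau> 0)"
proof (rule ccontr)
  assume "\<tau> (x + y) - \<tau> 0 \<noteq> (\<tau> x - \<tau> 0) + (\<tau> y - \<tau> 0)"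
  then have "\<tau> (x + y) + \<tau> 0 - (\<tau> x + \<tau> y) \<noteq> 0" by (simp add: algebra_simps)
  then obtain m where m: "character m" "m (\<tau> (x + y) + \<tau> 0 - (\<tau> x + \<tau> y)) \<noteq> 1"
    by (rule character_separates)
  have "m (\<tau> (x + y) + \<tau> 0) = m (\<tau> x + \<tau> y)"
    using character_of_equivariant_map[OF \<tau> m(1), of x y] by (simp add: character_add[OF m(1)])
  then show False
    using m(2) character_mult_cnj[OF m(1), of "\<tau> x + \<tau> y"] by (simp add: character_diff[OF m(1)])
qed

end

text \<open>
  The images of the iterates of an injective endomorphism decrease; once they stabilize, injectivity
  of the iterate shows that already the first image is everything.
\<close>

lemma (in mixing_action) injective_endomorphism_surjective:
  assumes dcc: "algebraic_dcc \<alpha>" and f: "continuous_on UNIV f" "equivariant \<alpha> f" "inj f"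
    and add: "\<And>x y. f (x + y) = f x + f y"
  shows "surj f"
proof -
  define H where "H i = range (f ^^ i)" for i
  have cont: "continuous_on UNIV (f ^^ i)" for i
    by (induction i) (auto simp: o_def id_def intro: continuous_compose[OF f(1)])
  have add_i: "(f ^^ i) (x + y) = (f ^^ i) x + (f ^^ i) y" for i x y
    by (induction i) (simp_all add: add)
  have act_i: "(f ^^ i) (\<alpha> g x) = \<alpha> g ((f ^^ i) x)" for i g x
    by (induction i) (use f(2) in \<open>simp_all add: equivariant_def\<close>)
  have zero_i: "(f ^^ i) 0 = 0" for i using add_i[of i 0 0] by simp
  have minus_i: "(f ^^ i) (- x) = - (f ^^ i) x" for i x
    using add_i[of i x "- x"] by (simp add: zero_i eq_neg_iff_add_eq_0 add.commute)
  have "closed_invariant_subgroup \<alpha> (H i)" for i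
    unfolding closed_invariant_subgroup_def
  proof (intro conjI ballI allI)
    show "closed (H i)"
      unfolding H_def by (intro closed_if_compact compact_continuous_image cont compact_group)
    show "0 \<in> H i" unfolding H_def using zero_i[of i] by (metis rangeI)
    show "x + y \<in> H i" if "x \<in> H i" "y \<in> H i" for x y
      using that unfolding H_def by (auto simp: add_i[symmetric])
    show "- x \<in> H i" if "x \<in> H i" for x
      using that unfolding H_def by (auto simp: minus_i[symmetric])
    show "\<alpha> g ` H i \<subseteq> H i" for g
      unfolding H_def by (auto simp: act_i[symmetric])
  qed
  moreover have "H 0 = UNIV" by (simp add: H_def)
  moreover have "H (Suc i) \<subseteq> H i" for i
    unfolding H_def by (auto simp: funpow_swap1)
  ultimately obtain k where k: "\<And>i. i \<ge> k \<Longrightarrow> H i = H k"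
    using dcc unfolding algebraic_dcc_def by blast
  have inj_k: "inj (f ^^ k)" using f(3) by (rule inj_fn)
  show ?thesis
  proof (unfold surj_def, intro allI)
    fix y
    have "(f ^^ k) y \<in> H (Suc k)" using k[of "Suc k"] by (simp add: H_def)
    then obtain x where "(f ^^ k) y = (f ^^ k) (f x)"
      unfolding H_def by (auto simp: funpow_swap1)
    then show "\<exists>x. y = f x" using inj_k by (blast dest: injD)
  qed
qed

theorem theorem1p5:
  fixes \<alpha> :: "int ^ 'd::finite \<Rightarrow> 'a::topological_ab_group_add \<Rightarrow> 'a"
    and \<mu> :: "'a measure"
  assumes "compact (UNIV :: 'a set)"
    and "metrizable_space (euclidean :: 'a topology)"
    and "connected (UNIV :: 'a set)"
    and "algebraic_action \<alpha>"
    and "haar_probability \<mu>"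
    and "mixing \<mu> \<alpha>"
    and "algebraic_dcc \<alpha>"
    and "topological_entropy \<alpha> < \<infinity>"
  shows "surjunctive \<alpha>"
  unfolding surjunctive_def
proof (intro allI impI)
  interpret connected_mixing_action \<mu> \<alpha>
    using assms by unfold_locales auto
  fix \<tau> assume \<tau>: "continuous_on UNIV \<tau> \<and> equivariant \<alpha> \<tau> \<and> inj \<tau>"
  define f where "f = (\<lambda>x. \<tau> x - \<tau> 0)"
  have fixed: "\<alpha> g (\<tau> 0) = \<tau> 0" for g
    using \<tau> by (metis act_zero equivariant_def)
  have act_minus: "\<alpha> g (x - y) = \<alpha> g x - \<alpha> g y" for g x y
    using act_hom[of g "x - y" y] by (simp add: eq_diff_eq)
  have "surj f"
  proof (rule injective_endomorphism_surjective[OF assms(7)])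
    show "continuous_on UNIV f" unfolding f_def using \<tau> by (intro continuous_intros) auto
    show "equivariant \<alpha> f"
      unfolding f_def equivariant_def using \<tau> by (simp add: act_minus fixed equivariant_def)
    show "inj f" unfolding f_def using \<tau> by (auto simp: inj_def)
    show "f (x + y) = f x + f y" for x y
      unfolding f_def using \<tau> by (intro equivariant_map_affine) auto
  qed
  show "surj \<tau>"
  proof (unfold surj_def, intro allI)
    fix y
    obtain x where "y - \<tau> 0 = f x" using \<open>surj f\<close> by (metis surjD)
    then show "\<exists>x. y = \<tau> x" by (auto simp: f_def)
  qed
qed

end
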